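(* There is an infinite set $N$ of positive integers such that, for $G\in\mathcal{G}(n,\frac12)$, with probability tending to $1$ as $n\to\infty$ along $N$, $$D_2(G)\le \log_2 n-2\log_2\ln n+\log_2\ln 2+6+o(1),$$ where $o(1)$ is a deterministic function tending to $0$.
   Context: Graphs are finite and simple. First order sentences about graphs use variables over vertices, the relations $=$ and $\sim$ (adjacency), quantifiers $\forall,\exists$, and Boolean connectives. The quantifier depth of a sentence is the maximum number of nested quantifiers. A sentence $A$ defines $G$ if $G\models A$ and $H\not\models A$ for all $H\not\cong G$. For a sentence with no quantifier in the scope of a negation, its alternation number is the maximum number of changes between $\exists$ and $\forall$ along a chain of nested quantifiers. $D_r(G)$ is the minimum depth of a sentence of alternation number at most $r$ defining $G$. $\mathcal{G}(n,\frac12)$ is the uniformly random graph on $\{1,\dots,n\}$ (each edge independently with probability $\frac12$). *)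

theory Defs
  imports
    "HOL-Probability.Probability"
    "Graph_Theory.Pair_Digraph"
    "Graph_Theory.Digraph_Isomorphism"
begin

text \<open>
  A finite simple graph is a symmetric loop-free finite digraph without parallel arcs, i.e. a
  \<^term>\<open>G\<close> with \<^term>\<open>pair_graph G\<close>; an edge between u and v is the pair of arcs
  (u,v), (v,u). Vertices are natural numbers, which loses nothing up to isomorphism.
\<close>

lemma digraph_iso_pair_iff:
  assumes "pair_graph G" "pair_graph H"
  shows "digraph_iso (with_proj G) (with_proj H) \<longleftrightarrow>
    (\<exists>f. bij_betw f (pverts G) (pverts H) \<and>
      (\<forall>u\<in>pverts G. \<forall>v\<in>pverts G. (u, v) \<in> parcs G \<longleftrightarrow> (f u, f v) \<in> parcs H))"
    (is "?L \<longleftrightarrow> ?R")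
proof
  interpret G: pair_graph G by fact
  interpret H: pair_graph H by fact
  assume ?L
  then obtain h where h: "pre_digraph.digraph_isomorphism (with_proj G) h"
    and H: "with_proj H = app_iso h (with_proj G)"
    by (auto simp: digraph_iso_def)
  let ?f = "iso_verts h"
  have V: "pverts H = ?f ` pverts G" and A: "parcs H = iso_arcs h ` parcs G"
    and t: "iso_tail h = fst" and hd: "iso_head h = snd"
    using arg_cong[OF H, of verts] arg_cong[OF H, of arcs]
      arg_cong[OF H, of tail] arg_cong[OF H, of head]
    by simp_all
  have inj: "inj_on ?f (pverts G)"
    and arc: "\<And>a. a \<in> parcs G \<Longrightarrow> iso_arcs h a = (?f (fst a), ?f (snd a))"
    using h by (auto simp: pre_digraph.digraph_isomorphism_def t hd prod_eq_iff)
  have A': "parcs H = (\<lambda>a. (?f (fst a), ?f (snd a))) ` parcs G"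
    unfolding A by (rule image_cong[OF refl]) (rule arc)
  have "(u, v) \<in> parcs G \<longleftrightarrow> (?f u, ?f v) \<in> parcs H"
    if "u \<in> pverts G" "v \<in> pverts G" for u v
  proof
    assume "(u, v) \<in> parcs G"
    then show "(?f u, ?f v) \<in> parcs H" unfolding A' by (force intro: rev_image_eqI)
  next
    assume "(?f u, ?f v) \<in> parcs H"
    then obtain x y where xy: "(x, y) \<in> parcs G" "?f u = ?f x" "?f v = ?f y"
      unfolding A' by auto
    then have "x \<in> pverts G" "y \<in> pverts G"
      using G.in_arcsD1 G.in_arcsD2 by auto
    then have "u = x" "v = y" using inj that xy(2,3) by (auto dest: inj_onD)
    then show "(u, v) \<in> parcs G" using xy by simp
  qed
  then show ?R using inj V by (intro exI[of _ ?f]) (auto simp: bij_betw_def)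
next
  interpret G: pair_graph G by fact
  interpret H: pair_graph H by fact
  assume ?R
  then obtain f where f: "bij_betw f (pverts G) (pverts H)"
    and adj: "\<And>u v. u \<in> pverts G \<Longrightarrow> v \<in> pverts G \<Longrightarrow>
      (u, v) \<in> parcs G \<longleftrightarrow> (f u, f v) \<in> parcs H"
    by blast
  let ?h = "\<lparr>iso_verts = f, iso_arcs = map_prod f f, iso_head = snd, iso_tail = fst\<rparr>"
  have inj: "inj_on f (pverts G)" and V: "f ` pverts G = pverts H"
    using f by (auto simp: bij_betw_def)
  have sub: "parcs G \<subseteq> pverts G \<times> pverts G"
    using G.in_arcsD1 G.in_arcsD2 by auto
  have injA: "inj_on (map_prod f f) (parcs G)"
    by (rule inj_on_subset[OF map_prod_inj_on[OF inj inj] sub])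
  have A: "map_prod f f ` parcs G = parcs H"
  proof
    show "map_prod f f ` parcs G \<subseteq> parcs H"
      using sub adj by auto
    show "parcs H \<subseteq> map_prod f f ` parcs G"
    proof
      fix e assume e: "e \<in> parcs H"
      obtain x y where xy: "e = (x, y)" by (cases e)
      then have "x \<in> f ` pverts G" "y \<in> f ` pverts G"
        using e H.in_arcsD1 H.in_arcsD2 V by auto
      then obtain u v where uv: "u \<in> pverts G" "v \<in> pverts G" "x = f u" "y = f v" by auto
      then have "(u, v) \<in> parcs G" using adj e xy by simp
      then show "e \<in> map_prod f f ` parcs G" using uv xy by (force intro: rev_image_eqI)
    qed
  qed
  have "pre_digraph.digraph_isomorphism (with_proj G) ?h"
    using inj injA G.wf_digraph by (simp add: pre_digraph.digraph_isomorphism_def)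
  moreover have "with_proj H = app_iso ?h (with_proj G)"
    using V A by (simp add: app_iso_def with_proj_def)
  ultimately show ?L by (auto simp: digraph_iso_def)
qed


datatype fo =
    Eq nat nat
  | Adj nat nat
  | Neg fo
  | Conj fo fo
  | Disj fo fo
  | Ex nat fo
  | All nat fo

primrec sat :: "'a pair_pre_digraph \<Rightarrow> (nat \<Rightarrow> 'a) \<Rightarrow> fo \<Rightarrow> bool" where
  "sat G e (Eq x y) \<longleftrightarrow> e x = e y"
| "sat G e (Adj x y) \<longleftrightarrow> (e x, e y) \<in> parcs G"
| "sat G e (Neg A) \<longleftrightarrow> \<not> sat G e A"
| "sat G e (Conj A B) \<longleftrightarrow> sat G e A \<and> sat G e B"
| "sat G e (Disj A B) \<longleftrightarrow> sat G e A \<or> sat G e B"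
| "sat G e (Ex x A) \<longleftrightarrow> (\<exists>v\<in>pverts G. sat G (e(x := v)) A)"
| "sat G e (All x A) \<longleftrightarrow> (\<forall>v\<in>pverts G. sat G (e(x := v)) A)"

primrec fv :: "fo \<Rightarrow> nat set" where
  "fv (Eq x y) = {x, y}"
| "fv (Adj x y) = {x, y}"
| "fv (Neg A) = fv A"
| "fv (Conj A B) = fv A \<union> fv B"
| "fv (Disj A B) = fv A \<union> fv B"
| "fv (Ex x A) = fv A - {x}"
| "fv (All x A) = fv A - {x}"

definition sentence :: "fo \<Rightarrow> bool" where
  "sentence A \<longleftrightarrow> fv A = {}"

lemma sat_cong_fv: "(\<And>x. x \<in> fv A \<Longrightarrow> e x = e' x) \<Longrightarrow> sat G e A \<longleftrightarrow> sat G e' A"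
proof (induction A arbitrary: e e')
  case (Ex x A)
  have "sat G (e(x := v)) A \<longleftrightarrow> sat G (e'(x := v)) A" for v
    by (rule Ex.IH) (use Ex.prems in auto)
  then show ?case by simp
next
  case (All x A)
  have "sat G (e(x := v)) A \<longleftrightarrow> sat G (e'(x := v)) A" for v
    by (rule All.IH) (use All.prems in auto)
  then show ?case by simp
next
  case (Neg A)
  then show ?case by (metis fv.simps(3) sat.simps(3))
next
  case (Conj A B)
  then show ?case by (metis UnCI fv.simps(4) sat.simps(4))
next
  case (Disj A B)
  then show ?case by (metis UnCI fv.simps(5) sat.simps(5))
qed simp_all

text \<open>
  The assignment is irrelevant for a sentence, so it is left arbitrary rather than confined to
  \<^term>\<open>pverts G\<close>; no special case arises for the graph without vertices.
\<close>
definition models :: "'a pair_pre_digraph \<Rightarrow> fo \<Rightarrow> bool" (infix "\<Turnstile>" 50) where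
  "G \<Turnstile> A \<longleftrightarrow> (\<forall>e. sat G e A)"

lemma models_iff_sat: "sentence A \<Longrightarrow> G \<Turnstile> A \<longleftrightarrow> sat G e A"
  unfolding models_def sentence_def by (metis empty_iff sat_cong_fv)

primrec qdepth :: "fo \<Rightarrow> nat" where
  "qdepth (Eq x y) = 0"
| "qdepth (Adj x y) = 0"
| "qdepth (Neg A) = qdepth A"
| "qdepth (Conj A B) = max (qdepth A) (qdepth B)"
| "qdepth (Disj A B) = max (qdepth A) (qdepth B)"
| "qdepth (Ex x A) = Suc (qdepth A)"
| "qdepth (All x A) = Suc (qdepth A)"

primrec no_quant_under_neg :: "fo \<Rightarrow> bool" where
  "no_quant_under_neg (Eq x y) \<longleftrightarrow> True"
| "no_quant_under_neg (Adj x y) \<longleftrightarrow> True"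
| "no_quant_under_neg (Neg A) \<longleftrightarrow> qdepth A = 0"
| "no_quant_under_neg (Conj A B) \<longleftrightarrow> no_quant_under_neg A \<and> no_quant_under_neg B"
| "no_quant_under_neg (Disj A B) \<longleftrightarrow> no_quant_under_neg A \<and> no_quant_under_neg B"
| "no_quant_under_neg (Ex x A) \<longleftrightarrow> no_quant_under_neg A"
| "no_quant_under_neg (All x A) \<longleftrightarrow> no_quant_under_neg A"

datatype quantifier = QEx | QAll

text \<open>
  The maximal chains of nested quantifiers, outermost first: one for each path from the root of the
  formula to an atom. Passing to a subchain cannot increase the number of changes.
\<close>
primrec quant_chains :: "fo \<Rightarrow> quantifier list set" where
  "quant_chains (Eq x y) = {[]}"
| "quant_chains (Adj x y) = {[]}"
| "quant_chains (Neg A) = quant_chains A"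
| "quant_chains (Conj A B) = quant_chains A \<union> quant_chains B"
| "quant_chains (Disj A B) = quant_chains A \<union> quant_chains B"
| "quant_chains (Ex x A) = (#) QEx ` quant_chains A"
| "quant_chains (All x A) = (#) QAll ` quant_chains A"

fun changes :: "quantifier list \<Rightarrow> nat" where
  "changes (p # q # qs) = (if p \<noteq> q then 1 else 0) + changes (q # qs)"
| "changes _ = 0"

text \<open>Meaningful only for formulas satisfying \<^const>\<open>no_quant_under_neg\<close>.\<close>
definition alternation :: "fo \<Rightarrow> nat" where
  "alternation A = Max (changes ` quant_chains A)"

lemma finite_quant_chains: "finite (quant_chains A)"
  and quant_chains_nonempty: "quant_chains A \<noteq> {}"
  by (induction A) auto

definition defines_graph :: "fo \<Rightarrow> nat pair_pre_digraph \<Rightarrow> bool" where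
  "defines_graph A G \<longleftrightarrow> sentence A \<and> G \<Turnstile> A \<and>
    (\<forall>H :: nat pair_pre_digraph.
      pair_graph H \<and> \<not> digraph_iso (with_proj H) (with_proj G) \<longrightarrow> \<not> H \<Turnstile> A)"

text \<open>
  \<^term>\<open>def_depth r G\<close> is $D_r(G)$. The infimum of a nonempty set in
  \<^typ>\<open>enat\<close> is its minimum; the empty set would give infinity, not a spurious 0.
\<close>
definition def_depth :: "nat \<Rightarrow> nat pair_pre_digraph \<Rightarrow> enat" where
  "def_depth r G =
    (INF A \<in> {A. defines_graph A G \<and> no_quant_under_neg A \<and> alternation A \<le> r}. enat (qdepth A))"

definition labelled_graphs :: "nat \<Rightarrow> nat pair_pre_digraph set" where
  "labelled_graphs n = {G. pair_graph G \<and> pverts G = {1..n}}"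

text \<open>
  The uniform distribution on the graphs with vertex set 1,...,n; equivalently each edge is present
  independently with probability 1/2.
\<close>
definition random_graph :: "nat \<Rightarrow> nat pair_pre_digraph pmf" where
  "random_graph n = pmf_of_set (labelled_graphs n)"

lemma finite_labelled_graphs: "finite (labelled_graphs n)"
proof (rule finite_subset)
  show "labelled_graphs n \<subseteq>
    (\<lambda>E. \<lparr>pverts = {1..n}, parcs = E\<rparr>) ` Pow ({1..n} \<times> {1..n})"
  proof
    fix G assume "G \<in> labelled_graphs n"
    then have g: "pair_graph G" and V: "pverts G = {1..n}" by (auto simp: labelled_graphs_def)
    interpret pair_graph G by fact
    have "parcs G \<subseteq> {1..n} \<times> {1..n}"
      using in_arcsD1 in_arcsD2 V by auto
    moreover have "G = \<lparr>pverts = {1..n}, parcs = parcs G\<rparr>" using V by simp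
    ultimately show "G \<in> (\<lambda>E. \<lparr>pverts = {1..n}, parcs = E\<rparr>) ` Pow ({1..n} \<times> {1..n})"
      by blast
  qed
qed simp

lemma labelled_graphs_nonempty: "labelled_graphs n \<noteq> {}"
proof -
  have "pair_graph \<lparr>pverts = {1..n}, parcs = {}\<rparr>"
    by unfold_locales (auto simp: symmetric_def sym_def)
  then show ?thesis by (force simp: labelled_graphs_def)
qed

end

theory Submission
  imports Defs "HOL-Real_Asymp.Real_Asymp"
begin

text \<open>
  Take n = 5/8 k^2 2^k, so that a k-set dominates the random graph (every outside vertex has a
  neighbour in the set) with probability about exp(- 5 k^2 / 8), against about 2^(k^2) ordered
  k-tuples. Because 5/8 < ln 2, a fixed vertex y starts a dominating k-tuple with high probability
  (second moment method); because 5/8 > 5/6 ln 2, such a tuple is usually the only dominating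
  tuple with its induced pattern, up to tuples that also start with y (first moment). Hence y is
  the only vertex satisfying "there are a_2, ..., a_k completing the pattern such that every vertex
  is dominated", which is an \<exists>\<forall>-formula of depth k.

  This is applied to the vertices of a fixed set Y with 3 k elements only: with high probability
  every vertex is determined by its adjacencies to Y, which costs one further quantifier. A last
  two quantifiers turn \<exists>\<forall>-definitions of all vertices into a defining sentence with two
  alternations, of depth k + 3. As k is log 2 n - 2 log 2 (ln n) + log 2 (ln 2) + O(1) with a
  constant below 3, this is within the bound.
\<close>

section \<open>Defining sentences\<close>

text \<open>Both bounds on the constant 5/8 come from weighing a single entry of a tuple. In the
  second moment, an entry shared by two tuples raises the chance of joint domination by a factor of
  about exp(5 k / 8), while fixing it loses about 2^k choices; hence 5/8 < ln 2. For a rival tuple,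
  a new entry has about 2^k choices, costs exp(- 5 k / 8) in domination, and only 2^(- k / 6) in
  pattern agreement, because decoupling keeps a third of the roughly k^2 / 2 edge constraints; hence
  5/8 > 5/6 ln 2. The resulting window for n / (k^2 2^k) has ratio 6/5, whereas raising k by one
  changes this quotient by a factor near 2. So these estimates reach only special n, which is why n
  runs along a sequence. Two devices let the moments be computed entry by entry: the exponent of the
  joint domination probability, exponential in the size of the overlap, is replaced by its linear
  chord; and candidate tuples take their entries from disjoint blocks, so that sums over them become
  products over positions.\<close>

primrec dual :: "fo \<Rightarrow> fo" where
  "dual (Eq x y) = Neg (Eq x y)"
| "dual (Adj x y) = Neg (Adj x y)"
| "dual (Neg A) = A"
| "dual (Conj A B) = Disj (dual A) (dual B)"
| "dual (Disj A B) = Conj (dual A) (dual B)"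
| "dual (Ex x A) = All x (dual A)"
| "dual (All x A) = Ex x (dual A)"

primrec flip_quant :: "quantifier \<Rightarrow> quantifier" where
  "flip_quant QEx = QAll"
| "flip_quant QAll = QEx"

lemma sat_dual [simp]: "sat G e (dual A) \<longleftrightarrow> \<not> sat G e A"
  by (induction A arbitrary: e) auto

lemma fv_dual [simp]: "fv (dual A) = fv A"
  by (induction A) auto

lemma qdepth_dual [simp]: "qdepth (dual A) = qdepth A"
  by (induction A) auto

lemma no_quant_under_neg_qfree: "qdepth A = 0 \<Longrightarrow> no_quant_under_neg A"
  by (induction A) auto

lemma quant_chains_qfree: "qdepth A = 0 \<Longrightarrow> quant_chains A = {[]}"
  by (induction A) auto

text \<open>The defining sentence has implications whose premises are quantified formulas, and no
  negation may stand above a quantifier; so negation is pushed inwards. The clause of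
  \<open>dual\<close> for \<open>Neg A\<close> does not recurse: it uncovers \<open>A\<close>, which
  is quantifier-free here.\<close>

lemma no_quant_under_neg_dual: "no_quant_under_neg A \<Longrightarrow> no_quant_under_neg (dual A)"
  by (induction A) (auto simp: no_quant_under_neg_qfree)

lemma quant_chains_dual:
  "no_quant_under_neg A \<Longrightarrow> quant_chains (dual A) = map flip_quant ` quant_chains A"
  by (induction A) (auto simp: quant_chains_qfree image_Un image_image)

lemma flip_quant_eq_iff [simp]: "flip_quant p = flip_quant q \<longleftrightarrow> p = q"
  by (cases p; cases q) auto

lemma changes_map_flip [simp]: "changes (map flip_quant c) = changes c"
  by (induction c rule: changes.induct) auto

lemma changes_Cons_le: "changes (p # c) \<le> Suc (changes c)"
  by (cases c) auto

lemma changes_replicate [simp]: "changes (replicate a p) = 0"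
proof (induction a)
  case (Suc a)
  then show ?case by (cases a) auto
qed simp

lemma changes_two_blocks: "changes (replicate a p @ replicate b q) \<le> 1"
proof (induction a)
  case (Suc a)
  show ?case
  proof (cases a)
    case 0
    then show ?thesis using changes_Cons_le[of p "replicate b q"] by simp
  next
    case (Suc a')
    then show ?thesis using Suc.IH by simp
  qed
qed simp

lemma alternation_leI: "(\<And>c. c \<in> quant_chains A \<Longrightarrow> changes c \<le> r) \<Longrightarrow> alternation A \<le> r"
  unfolding alternation_def using finite_quant_chains[of A] quant_chains_nonempty[of A] by simp

text \<open>Keeps the shape of the chains rather than their number of changes: a bound on changes
  alone would not survive another \<open>Ex\<close> in front. Either block may be empty.\<close>

definition sigma2 :: "fo \<Rightarrow> bool" where
  "sigma2 A \<longleftrightarrow> no_quant_under_neg A \<and>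
    quant_chains A \<subseteq> {replicate a QEx @ replicate b QAll | a b. True}"

lemma sigma2_qfree: "qdepth A = 0 \<Longrightarrow> sigma2 A"
  unfolding sigma2_def by (auto simp: no_quant_under_neg_qfree quant_chains_qfree)

lemma sigma2_Conj [intro]: "sigma2 A \<Longrightarrow> sigma2 B \<Longrightarrow> sigma2 (Conj A B)"
  by (auto simp: sigma2_def)

lemma sigma2_Ex [intro]: "sigma2 A \<Longrightarrow> sigma2 (Ex x A)"
proof -
  assume A: "sigma2 A"
  have "QEx # c \<in> {replicate a QEx @ replicate b QAll | a b. True}" if "c \<in> quant_chains A" for c
  proof -
    have "c \<in> {replicate a QEx @ replicate b QAll | a b. True}"
      using that by (rule subsetD[rotated]) (use A in \<open>simp add: sigma2_def\<close>)
    then obtain a b where "c = replicate a QEx @ replicate b QAll" by auto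
    then have "QEx # c = replicate (Suc a) QEx @ replicate b QAll" by simp
    then show ?thesis by blast
  qed
  then show ?thesis using A by (auto simp: sigma2_def)
qed

lemma sigma2_All_qfree: "qdepth A = 0 \<Longrightarrow> sigma2 (All x A)"
proof -
  assume A: "qdepth A = 0"
  have "[QAll] = replicate 0 QEx @ replicate 1 QAll" by simp
  then show ?thesis using A
    unfolding sigma2_def by (auto simp: no_quant_under_neg_qfree quant_chains_qfree simp del: replicate.simps)
qed

lemma changes_sigma2: "sigma2 A \<Longrightarrow> c \<in> quant_chains A \<Longrightarrow> changes c \<le> 1"
  unfolding sigma2_def using changes_two_blocks by blast

lemma changes_sigma2_dual: "sigma2 A \<Longrightarrow> c \<in> quant_chains (dual A) \<Longrightarrow> changes c \<le> 1"
  using changes_sigma2[of A] quant_chains_dual[of A] by (auto simp: sigma2_def)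

section \<open>Literals, atomic types, finite conjunctions and disjunctions, existential
  prefixes\<close>

definition literal :: "bool \<Rightarrow> fo \<Rightarrow> fo" where
  "literal b A = (if b then A else Neg A)"

lemma sat_literal [simp]: "sat G e (literal b A) \<longleftrightarrow> (sat G e A \<longleftrightarrow> b)"
  and fv_literal [simp]: "fv (literal b A) = fv A"
  and qdepth_literal [simp]: "qdepth (literal b A) = qdepth A"
  by (auto simp: literal_def)

definition atomic_type :: "bool \<Rightarrow> bool \<Rightarrow> nat \<Rightarrow> nat \<Rightarrow> fo" where
  "atomic_type b c i j = Conj (literal b (Eq i j)) (literal c (Adj i j))"

lemma sat_atomic_type [simp]:
    "sat G e (atomic_type b c i j) \<longleftrightarrow> (e i = e j \<longleftrightarrow> b) \<and> ((e i, e j) \<in> parcs G \<longleftrightarrow> c)"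
  and fv_atomic_type [simp]: "fv (atomic_type b c i j) = {i, j}"
  and qdepth_atomic_type [simp]: "qdepth (atomic_type b c i j) = 0"
  by (auto simp: atomic_type_def)

lemma sat_foldr_Conj [simp]:
    "sat G e (foldr Conj As B) \<longleftrightarrow> (\<forall>A\<in>set As. sat G e A) \<and> sat G e B"
  and sat_foldr_Disj [simp]:
    "sat G e (foldr Disj As B) \<longleftrightarrow> (\<exists>A\<in>set As. sat G e A) \<or> sat G e B"
  by (induction As) auto

lemma fv_foldr_Conj [simp]: "fv (foldr Conj As B) = (\<Union>A\<in>set As. fv A) \<union> fv B"
  and fv_foldr_Disj [simp]: "fv (foldr Disj As B) = (\<Union>A\<in>set As. fv A) \<union> fv B"
  by (induction As) auto

lemma qdepth_foldr_Conj [simp]: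
    "qdepth (foldr Conj As B) \<le> d \<longleftrightarrow> (\<forall>A\<in>set As. qdepth A \<le> d) \<and> qdepth B \<le> d"
  and qdepth_foldr_Disj [simp]:
    "qdepth (foldr Disj As B) \<le> d \<longleftrightarrow> (\<forall>A\<in>set As. qdepth A \<le> d) \<and> qdepth B \<le> d"
  by (induction As) auto

lemma no_quant_under_neg_foldr_Conj [simp]:
    "no_quant_under_neg (foldr Conj As B) \<longleftrightarrow> (\<forall>A\<in>set As. no_quant_under_neg A) \<and> no_quant_under_neg B"
  and no_quant_under_neg_foldr_Disj [simp]:
    "no_quant_under_neg (foldr Disj As B) \<longleftrightarrow> (\<forall>A\<in>set As. no_quant_under_neg A) \<and> no_quant_under_neg B"
  by (induction As) auto

lemma quant_chains_foldr_Conj [simp]: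
    "quant_chains (foldr Conj As B) = (\<Union>A\<in>set As. quant_chains A) \<union> quant_chains B"
  and quant_chains_foldr_Disj [simp]:
    "quant_chains (foldr Disj As B) = (\<Union>A\<in>set As. quant_chains A) \<union> quant_chains B"
  by (induction As) auto

lemma sigma2_foldr_Conj: "(\<And>A. A \<in> set As \<Longrightarrow> sigma2 A) \<Longrightarrow> sigma2 B \<Longrightarrow> sigma2 (foldr Conj As B)"
  by (induction As) auto

text \<open>Treats a block of quantifiers as a single choice of an assignment, from which a whole
  tuple can be read off.\<close>

lemma sat_foldr_Ex:
  "sat G e (foldr Ex xs A) \<longleftrightarrow>
    (\<exists>e'. (\<forall>x. x \<notin> set xs \<longrightarrow> e' x = e x) \<and> (\<forall>x\<in>set xs. e' x \<in> pverts G) \<and> sat G e' A)"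
proof (induction xs arbitrary: e)
  case Nil
  have "e' = e" if "\<forall>x. e' x = e x" for e' using that by auto
  then show ?case by auto
next
  case (Cons x xs)
  show ?case (is "?L \<longleftrightarrow> ?R")
  proof
    assume ?L
    then obtain v e' where "v \<in> pverts G" "\<forall>y. y \<notin> set xs \<longrightarrow> e' y = (e(x := v)) y"
      "\<forall>x\<in>set xs. e' x \<in> pverts G" "sat G e' A"
      by (auto simp: Cons.IH)
    then show ?R by (intro exI[of _ e']) (auto split: if_splits)
  next
    assume ?R
    then obtain e' where e': "\<forall>y. y \<notin> set (x # xs) \<longrightarrow> e' y = e y"
      "\<forall>y\<in>set (x # xs). e' y \<in> pverts G" "sat G e' A" by blast
    then have "sat G (e(x := e' x)) (foldr Ex xs A)"
      unfolding Cons.IH by (intro exI[of _ e']) auto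
    then show ?L using e' by auto
  qed
qed

lemma fv_foldr_Ex [simp]: "fv (foldr Ex xs A) = fv A - set xs"
  and qdepth_foldr_Ex [simp]: "qdepth (foldr Ex xs A) = length xs + qdepth A"
  and sigma2_foldr_Ex: "sigma2 A \<Longrightarrow> sigma2 (foldr Ex xs A)"
  by (induction xs) auto

text \<open>
  The defining sentence says that every \<open>\<psi> x\<close> is realised, that every vertex realises some
  \<open>\<psi> x\<close>, and that a realisation of \<open>\<psi> x\<close> and one of \<open>\<psi> x'\<close> are related as x and x' are;
  the case of equal vertices in the last part makes realisations unique.
\<close>
lemma def_depth_le_of_definable_vertices:
  fixes G :: "nat pair_pre_digraph"
  assumes G: "pair_graph G"
    and sat: "\<And>(H :: nat pair_pre_digraph) e s x. s < 2 \<Longrightarrow> sat H e (\<psi> s x) \<longleftrightarrow> T H x (e s)"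
    and T: "\<And>x v. x \<in> pverts G \<Longrightarrow> v \<in> pverts G \<Longrightarrow> T G x v \<longleftrightarrow> v = x"
    and fv: "\<And>s x. s < 2 \<Longrightarrow> fv (\<psi> s x) \<subseteq> {s}"
    and sigma2: "\<And>s x. s < 2 \<Longrightarrow> sigma2 (\<psi> s x)"
    and depth: "\<And>s x. s < 2 \<Longrightarrow> qdepth (\<psi> s x) \<le> d"
  shows "def_depth 2 G \<le> enat (d + 2)"
proof -
  interpret G: pair_graph G by fact
  obtain xs where xs: "set xs = pverts G"
    using finite_list[of "pverts G"] G.finite_verts by auto
  define ex where "ex = map (\<lambda>x. Ex 0 (\<psi> 0 x)) xs"
  \<comment> \<open>\<open>Neg (Eq 0 0)\<close> is the false base of the disjunction; for the graph
    without vertices, \<open>cov\<close> thus says that there are none.\<close>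
  define cov where "cov = All 0 (foldr Disj (map (\<psi> 0) xs) (Neg (Eq 0 0)))"
  \<comment> \<open>Two descriptions are compared here, which is why \<open>\<psi>\<close> is
    supplied in two copies, with free variable 0 and 1.\<close>
  define rel where "rel = (\<lambda>x x'. All 0 (All 1 (Disj (dual (\<psi> 0 x)) (Disj (dual (\<psi> 1 x'))
    (atomic_type (x = x') ((x, x') \<in> parcs G) 0 1)))))"
  define A where "A = foldr Conj (ex @ map (\<lambda>(x, x'). rel x x') (List.product xs xs)) cov"
  have sat_A: "sat H e A \<longleftrightarrow> (\<forall>x\<in>pverts G. \<exists>v\<in>pverts H. T H x v) \<and>
      (\<forall>v\<in>pverts H. \<exists>x\<in>pverts G. T H x v) \<and>
      (\<forall>x\<in>pverts G. \<forall>x'\<in>pverts G. \<forall>u\<in>pverts H. \<forall>v\<in>pverts H. T H x u \<longrightarrow> T H x' v \<longrightarrow>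
        (u = v \<longleftrightarrow> x = x') \<and> ((u, v) \<in> parcs H \<longleftrightarrow> (x, x') \<in> parcs G))"
      (is "_ \<longleftrightarrow> ?E \<and> ?C \<and> ?R") for H :: "nat pair_pre_digraph" and e
  proof -
    have "(\<forall>B\<in>set ex. sat H e B) \<longleftrightarrow> ?E" by (simp add: ex_def sat xs)
    moreover have "sat H e cov \<longleftrightarrow> ?C" by (simp add: cov_def sat xs)
    moreover have "sat H e (rel x x') \<longleftrightarrow> (\<forall>u\<in>pverts H. \<forall>v\<in>pverts H. T H x u \<longrightarrow> T H x' v \<longrightarrow>
        (u = v \<longleftrightarrow> x = x') \<and> ((u, v) \<in> parcs H \<longleftrightarrow> (x, x') \<in> parcs G))" for x x'
      by (simp add: rel_def sat) blast
    then have "(\<forall>B\<in>set (map (\<lambda>(x, x'). rel x x') (List.product xs xs)). sat H e B) \<longleftrightarrow> ?R"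
      by (simp add: xs)
    ultimately show ?thesis
      unfolding A_def sat_foldr_Conj set_append ball_Un by (simp only: conj_ac)
  qed
  have "fv (\<psi> 0 x) \<subseteq> {0}" "fv (\<psi> 1 x) \<subseteq> {1}" for x
    using fv by simp_all
  then have "fv (Ex 0 (\<psi> 0 x)) = {}" "fv (rel x x') = {}" "fv cov = {}" for x x'
    unfolding rel_def cov_def by auto
  then have sent: "sentence A"
    unfolding sentence_def A_def ex_def by auto
  have "sat G e A" for e
    unfolding sat_A using T by auto
  then have GA: "G \<Turnstile> A" by (simp add: models_def)
  have iso: "digraph_iso (with_proj H) (with_proj G)" if H: "pair_graph H" "H \<Turnstile> A"
    for H :: "nat pair_pre_digraph"
  proof -
    have s: "sat H undefined A" using H by (simp add: models_def)
    have real: "\<forall>x\<in>pverts G. \<exists>v\<in>pverts H. T H x v"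
      using s unfolding sat_A by (rule conjunct1)
    have "\<forall>v\<in>pverts H. \<exists>x. x \<in> pverts G \<and> T H x v" using s unfolding sat_A by blast
    \<comment> \<open>\<open>cov\<close> labels every vertex of \<open>H\<close> by a vertex of
      \<open>G\<close>; \<open>rel\<close> will make the label unique and \<open>f\<close> an
      isomorphism.\<close>
    then obtain f where f: "\<And>v. v \<in> pverts H \<Longrightarrow> f v \<in> pverts G \<and> T H (f v) v" by metis
    have r: "(u = v \<longleftrightarrow> x = x') \<and> ((u, v) \<in> parcs H \<longleftrightarrow> (x, x') \<in> parcs G)"
      if "T H x u" "T H x' v" "x \<in> pverts G" "x' \<in> pverts G" "u \<in> pverts H" "v \<in> pverts H"
      for x x' u v using s that unfolding sat_A by blast
    have "u = v" if "u \<in> pverts H" "v \<in> pverts H" "f u = f v" for u v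
      using r[of "f u" u "f v" v] f[OF that(1)] f[OF that(2)] that(1,2) unfolding that(3) by blast
    then have "inj_on f (pverts H)" by (rule inj_onI)
    moreover have "f ` pverts H = pverts G"
    proof
      show "f ` pverts H \<subseteq> pverts G" using f by blast
      show "pverts G \<subseteq> f ` pverts H"
      proof
        fix x assume x: "x \<in> pverts G"
        then obtain v where v: "v \<in> pverts H" "T H x v" using real by blast
        \<comment> \<open>\<open>rel\<close> is applied with the same vertex v on both sides: v = v
          forces its two labels to be equal.\<close>
        then have "f v = x" using r[of "f v" v x v] f[OF v(1)] x by blast
        then show "x \<in> f ` pverts H" using v by blast
      qed
    qed
    moreover have "(u, v) \<in> parcs H \<longleftrightarrow> (f u, f v) \<in> parcs G"
      if "u \<in> pverts H" "v \<in> pverts H" for u v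
      using r[of "f u" u "f v" v] f[OF that(1)] f[OF that(2)] that by blast
    ultimately show ?thesis
      unfolding digraph_iso_pair_iff[OF H(1) G] bij_betw_def by (intro exI[of _ f] conjI ballI)
  qed
  have "defines_graph A G"
    unfolding defines_graph_def
    by (intro conjI allI impI notI sent GA) (elim conjE notE, rule iso)
  moreover have nq: "no_quant_under_neg (\<psi> s x)" "no_quant_under_neg (dual (\<psi> s x))" if "s < 2" for s x
    using sigma2[OF that] by (auto simp: sigma2_def no_quant_under_neg_dual)
  then have "no_quant_under_neg A"
    by (auto simp: A_def ex_def cov_def rel_def no_quant_under_neg_qfree)
  moreover have "alternation A \<le> 2"
  \<comment> \<open>Only \<open>cov\<close> can really reach two changes, as a universal quantifier
    above an \<exists>\<forall>-chain; for the other conjuncts a crude count is enough.\<close>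
  proof (rule alternation_leI)
    fix c assume "c \<in> quant_chains A"
    then consider x where "c \<in> quant_chains (Ex 0 (\<psi> 0 x))"
      | x x' where "c \<in> quant_chains (rel x x')" | "c \<in> quant_chains cov"
      unfolding A_def ex_def by (auto simp del: quant_chains.simps)
    then show "changes c \<le> 2"
    proof cases
      case (1 x)
      then obtain c' where c: "c = QEx # c'" "changes c' \<le> 1" using changes_sigma2[OF sigma2[of 0]] by auto
      then show ?thesis using changes_Cons_le[of QEx c'] by simp
    next
      case (2 x x')
      then obtain c' where "c = QAll # QAll # c'"
        and "c' \<in> quant_chains (dual (\<psi> 0 x)) \<union> quant_chains (dual (\<psi> 1 x')) \<union> {[]}"
        unfolding rel_def by (auto simp: quant_chains_qfree)
      moreover from this have "changes c' \<le> 1"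
        using changes_sigma2_dual[OF sigma2[of 0]]
          changes_sigma2_dual[OF sigma2[of 1]] by auto
      ultimately show ?thesis using changes_Cons_le[of QAll c'] by simp
    next
      case 3
      then obtain c' where "c = QAll # c'" and "c' = [] \<or> (\<exists>x. c' \<in> quant_chains (\<psi> 0 x))"
        unfolding cov_def by auto
      moreover from this have "changes c' \<le> 1"
        using changes_sigma2[OF sigma2[of 0]] by auto
      ultimately show ?thesis using changes_Cons_le[of QAll c'] by simp
    qed
  qed
  ultimately have "def_depth 2 G \<le> enat (qdepth A)"
    unfolding def_depth_def by (intro INF_lower) auto
  also have "qdepth A \<le> d + 2"
  proof -
    have "qdepth (rel x x') \<le> d + 2" for x x'
      using depth[of 0 x] depth[of 1 x'] by (simp add: rel_def)
    moreover have "qdepth (foldr Disj (map (\<psi> 0) xs) (Neg (Eq 0 0))) \<le> d"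
      using depth[of 0] by simp
    then have "qdepth cov \<le> d + 2" unfolding cov_def qdepth.simps by linarith
    moreover have "qdepth (Ex 0 (\<psi> 0 x)) \<le> d + 2" for x
      using depth[of 0 x] by simp
    ultimately show ?thesis
      unfolding A_def ex_def qdepth_foldr_Conj by auto
  qed
  finally show ?thesis by simp
qed

section \<open>Vertices pinned by dominating tuples\<close>

text \<open>An edge is a two-element set here, one object per adjacency instead of two opposite
  arcs, so that a random graph is a uniformly random subset of a finite set.\<close>

definition pairs :: "'a set \<Rightarrow> 'a set set" where
  "pairs V = {e. e \<subseteq> V \<and> card e = 2}"

lemma finite_pairs [simp]: "finite V \<Longrightarrow> finite (pairs V)"
  unfolding pairs_def by (rule finite_subset[of _ "Pow V"]) auto

lemma pair_in_pairs_iff [simp]: "{u, v} \<in> pairs V \<longleftrightarrow> u \<in> V \<and> v \<in> V \<and> u \<noteq> v"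
  by (auto simp: pairs_def card_2_iff doubleton_eq_iff)

definition graph_of :: "'a set \<Rightarrow> 'a set set \<Rightarrow> 'a pair_pre_digraph" where
  "graph_of V S = \<lparr>pverts = V, parcs = {(u, v). {u, v} \<in> S}\<rparr>"

lemma pverts_graph_of [simp]: "pverts (graph_of V S) = V"
  and parcs_graph_of [simp]: "(u, v) \<in> parcs (graph_of V S) \<longleftrightarrow> {u, v} \<in> S"
  by (auto simp: graph_of_def)

lemma edge_endpoints: "S \<subseteq> pairs V \<Longrightarrow> {u, v} \<in> S \<Longrightarrow> u \<in> V \<and> v \<in> V \<and> u \<noteq> v"
  by (metis pair_in_pairs_iff subsetD)

lemma pair_graph_graph_of:
  assumes "finite V" "S \<subseteq> pairs V"
  shows "pair_graph (graph_of V S)"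
proof
  have "parcs (graph_of V S) \<subseteq> V \<times> V"
    using edge_endpoints[OF assms(2)] by (auto simp: graph_of_def)
  then show "finite (parcs (graph_of V S))"
    using assms(1) finite_subset by blast
  show "symmetric (with_proj (graph_of V S))"
    by (auto simp: graph_of_def symmetric_def sym_def insert_commute arcs_ends_def
        arc_to_ends_def image_def)
qed (use assms edge_endpoints[OF assms(2)] in \<open>auto simp: graph_of_def\<close>)

definition dominates :: "'a set \<Rightarrow> 'a set set \<Rightarrow> 'a set \<Rightarrow> bool" where
  "dominates V S A \<longleftrightarrow> (\<forall>z\<in>V - A. \<exists>a\<in>A. {z, a} \<in> S)"

definition same_pattern :: "nat \<Rightarrow> 'a set set \<Rightarrow> (nat \<Rightarrow> 'a) \<Rightarrow> (nat \<Rightarrow> 'a) \<Rightarrow> bool" where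
  "same_pattern k S a b \<longleftrightarrow> (\<forall>p<k. \<forall>q<k. {a p, a q} \<in> S \<longleftrightarrow> {b p, b q} \<in> S)"

definition dom_tuple :: "'a set \<Rightarrow> 'a set set \<Rightarrow> nat \<Rightarrow> (nat \<Rightarrow> 'a) \<Rightarrow> bool" where
  "dom_tuple V S k a \<longleftrightarrow>
    a ` {..<k} \<subseteq> V \<and> inj_on a {..<k} \<and> dominates V S (a ` {..<k})"

definition pins :: "'a set \<Rightarrow> 'a set set \<Rightarrow> nat \<Rightarrow> (nat \<Rightarrow> 'a) \<Rightarrow> bool" where
  "pins V S k a \<longleftrightarrow> dom_tuple V S k a \<and>
    (\<forall>b. dom_tuple V S k b \<longrightarrow> same_pattern k S a b \<longrightarrow> b 0 = a 0)"

text \<open>Confined to vertices outside Y, since a vertex of Y will be recognised by its equality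
  with an element of Y.\<close>

definition separates :: "'a set \<Rightarrow> 'a set set \<Rightarrow> 'a set \<Rightarrow> bool" where
  "separates V S Y \<longleftrightarrow> (\<forall>x\<in>V - Y. \<forall>x'\<in>V - Y. x \<noteq> x' \<longrightarrow> (\<exists>y\<in>Y. ({x, y} \<in> S) \<noteq> ({x', y} \<in> S)))"

text \<open>
  The variable 2 + p stands for the p-th entry of the tuple, so the vertex to be defined is the
  value of the free variable 2; the variable k + 2 ranges over the vertices to be dominated.
\<close>
definition pin_formula :: "'a set set \<Rightarrow> nat \<Rightarrow> (nat \<Rightarrow> 'a) \<Rightarrow> fo" where
  "pin_formula S k a = foldr Ex [3..<k + 2]
    (Conj
      (foldr Conj (map (\<lambda>(p, q). atomic_type (a p = a q) ({a p, a q} \<in> S) (p + 2) (q + 2))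
        (List.product [0..<k] [0..<k])) (Eq 2 2))
      (All (k + 2) (foldr Disj (map (\<lambda>p. Disj (Eq (k + 2) (p + 2)) (Adj (k + 2) (p + 2))) [0..<k])
        (Neg (Eq 2 2)))))"

lemma fv_pin_formula: "fv (pin_formula S k a) \<subseteq> {2}"
  by (auto simp: pin_formula_def)

lemma qdepth_foldr_0 [simp]:
  "qdepth (foldr Conj As B) = 0 \<longleftrightarrow> (\<forall>A\<in>set As. qdepth A = 0) \<and> qdepth B = 0"
  "qdepth (foldr Disj As B) = 0 \<longleftrightarrow> (\<forall>A\<in>set As. qdepth A = 0) \<and> qdepth B = 0"
  by (induction As) auto

lemma sigma2_pin_formula: "sigma2 (pin_formula S k a)"
  unfolding pin_formula_def
  by (intro sigma2_foldr_Ex sigma2_Conj sigma2_All_qfree sigma2_qfree) auto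

text \<open>Entry 0 stays free, so k - 1 existential quantifiers remain, and the domination clause
  adds one universal quantifier.\<close>

lemma qdepth_pin_formula:
  assumes "k \<ge> 1"
  shows "qdepth (pin_formula S k a) \<le> k"
proof -
  have "qdepth (foldr Conj (map (\<lambda>(p, q). atomic_type (a p = a q) ({a p, a q} \<in> S) (p + 2) (q + 2))
        (List.product [0..<k] [0..<k])) (Eq 2 2)) = 0"
    "qdepth (foldr Disj (map (\<lambda>p. Disj (Eq (k + 2) (p + 2)) (Adj (k + 2) (p + 2))) [0..<k])
        (Neg (Eq 2 2))) = 0"
    by auto
  then show ?thesis using assms
    unfolding pin_formula_def qdepth_foldr_Ex qdepth.simps length_upt by simp
qed

lemma sat_pin_formula:
  assumes "k \<ge> 1" "pins V S k a" "e 2 \<in> V"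
  shows "sat (graph_of V S) e (pin_formula S k a) \<longleftrightarrow> e 2 = a 0"
proof -
  define pat where "pat = (\<lambda>f :: nat \<Rightarrow> 'a. \<forall>p<k. \<forall>q<k.
    (f (p + 2) = f (q + 2) \<longleftrightarrow> a p = a q) \<and> ({f (p + 2), f (q + 2)} \<in> S \<longleftrightarrow> {a p, a q} \<in> S))"
  define dom where "dom = (\<lambda>f :: nat \<Rightarrow> 'a. \<forall>z\<in>V. \<exists>p<k. z = f (p + 2) \<or> {z, f (p + 2)} \<in> S)"
  have sat: "sat (graph_of V S) e (pin_formula S k a) \<longleftrightarrow>
    (\<exists>f. (\<forall>x. x \<notin> {3..<k + 2} \<longrightarrow> f x = e x) \<and> (\<forall>x\<in>{3..<k + 2}. f x \<in> V) \<and> pat f \<and> dom f)"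
  proof -
    have "sat (graph_of V S) f (foldr Conj
        (map (\<lambda>(p, q). atomic_type (a p = a q) ({a p, a q} \<in> S) (p + 2) (q + 2))
          (List.product [0..<k] [0..<k])) (Eq 2 2)) \<longleftrightarrow> pat f" for f
      by (simp add: pat_def del: add_2_eq_Suc') auto
    moreover have "sat (graph_of V S) f (All (k + 2)
        (foldr Disj (map (\<lambda>p. Disj (Eq (k + 2) (p + 2)) (Adj (k + 2) (p + 2))) [0..<k])
          (Neg (Eq 2 2)))) \<longleftrightarrow> dom f" for f
      by (simp add: dom_def Bex_def del: add_2_eq_Suc')
    ultimately show ?thesis
      unfolding pin_formula_def sat_foldr_Ex sat.simps(4) set_upt by simp
  qed
  have a: "a ` {..<k} \<subseteq> V" "inj_on a {..<k}" "dominates V S (a ` {..<k})"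
    using assms(2) by (auto simp: pins_def dom_tuple_def)
  show ?thesis
  proof
    assume "sat (graph_of V S) e (pin_formula S k a)"
    then obtain f where f: "\<And>x. x \<notin> {3..<k + 2} \<Longrightarrow> f x = e x"
      "\<And>x. x \<in> {3..<k + 2} \<Longrightarrow> f x \<in> V" "pat f" "dom f"
      unfolding sat by blast
    \<comment> \<open>The values of the tuple variables form a competitor of a; \<open>pins\<close>
      then determines its entry 0, which is \<open>e 2\<close>.\<close>
    define b where "b = (\<lambda>p. f (p + 2))"
    have b0: "b 0 = e 2" using f(1)[of 2] by (simp add: b_def numeral_2_eq_2)
    have "b p \<in> V" if "p < k" for p
      using f(2)[of "p + 2"] b0 assms(3) that by (cases "p = 0") (auto simp: b_def)
    then have "b ` {..<k} \<subseteq> V" by auto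
    moreover have "inj_on b {..<k}"
      using f(3) a(2) unfolding pat_def b_def by (auto simp: inj_on_def)
    moreover have "dominates V S (b ` {..<k})"
      using f(4) unfolding dom_def dominates_def b_def by blast
    moreover have "same_pattern k S a b"
      using f(3) unfolding pat_def same_pattern_def b_def by blast
    ultimately show "e 2 = a 0"
      using assms(2) b0 by (auto simp: pins_def dom_tuple_def)
  next
    assume e: "e 2 = a 0"
    define f where "f = (\<lambda>x. if x \<in> {3..<k + 2} then a (x - 2) else e x)"
    have fa: "f (p + 2) = a p" if "p < k" for p
      using that e by (cases "p = 0") (auto simp: f_def numeral_2_eq_2)
    have "f x \<in> V" if "x \<in> {3..<k + 2}" for x
      using that a(1) by (auto simp: f_def)
    moreover have "pat f"
      using a(2) by (simp add: pat_def fa inj_on_def del: add_2_eq_Suc')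
    moreover have "dom f"
      unfolding dom_def
    proof
      fix z assume "z \<in> V"
      then obtain p where "p < k" "z = a p \<or> {z, a p} \<in> S"
        using a(3) unfolding dominates_def by blast
      then show "\<exists>p<k. z = f (p + 2) \<or> {z, f (p + 2)} \<in> S"
        using fa by metis
    qed
    ultimately show "sat (graph_of V S) e (pin_formula S k a)"
      unfolding sat by (intro exI[of _ f]) (auto simp: f_def)
  qed
qed

text \<open>A vertex x is described by stating, for each y in Y, whether x equals y and whether it
  is adjacent to y. Here y is named as the vertex satisfying its pin formula, so descriptions have
  depth k + 1, and the defining sentence adds 2.\<close>

lemma def_depth_graph_of_le:
  assumes V: "finite V" and S: "S \<subseteq> pairs V" and Y: "Y \<subseteq> V" and k: "k \<ge> 1"
    and pins: "\<And>y. y \<in> Y \<Longrightarrow> \<exists>a. pins V S k a \<and> a 0 = y"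
    and sep: "separates V S Y"
  shows "def_depth 2 (graph_of V S) \<le> enat (k + 3)"
proof -
  obtain \<alpha> where \<alpha>: "\<And>y. y \<in> Y \<Longrightarrow> pins V S k (\<alpha> y) \<and> \<alpha> y 0 = y"
    using pins by metis
  obtain ys where ys: "set ys = Y"
    using finite_list finite_subset[OF Y V] by auto
  let ?\<phi> = "\<lambda>y. pin_formula S k (\<alpha> y)"
  \<comment> \<open>Variables 0 and 1 belong to the two copies of the description; therefore the
    tuples of the pin formulas start at variable 2.\<close>
  define \<psi> where "\<psi> = (\<lambda>s x. foldr Conj
    (map (\<lambda>y. Ex 2 (Conj (?\<phi> y) (atomic_type (y = x) ({y, x} \<in> S) 2 s))) ys) (Eq s s))"
  \<comment> \<open>Stated for arbitrary \<open>H\<close>, where a pin formula may hold of several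
    vertices or of none, because the final sentence is evaluated in every graph. The constant
    assignment is legitimate as only variable 2 is free.\<close>
  define T where "T = (\<lambda>(H :: nat pair_pre_digraph) x v. \<forall>y\<in>Y. \<exists>w\<in>pverts H.
    sat H (\<lambda>_. w) (?\<phi> y) \<and> (w = v \<longleftrightarrow> y = x) \<and> ((w, v) \<in> parcs H \<longleftrightarrow> {y, x} \<in> S))"
  have \<phi>: "sat H e (?\<phi> y) \<longleftrightarrow> sat H (\<lambda>_. e 2) (?\<phi> y)" for H :: "nat pair_pre_digraph" and e y
    by (rule sat_cong_fv) (use fv_pin_formula in fastforce)
  have \<phi>1: "sat (graph_of V S) (\<lambda>_. w) (?\<phi> y) \<longleftrightarrow> w = y" if "y \<in> Y" "w \<in> V" for y w
    using sat_pin_formula[OF k, of V S "\<alpha> y" "\<lambda>_. w"] \<alpha>[OF that(1)] that(2) by simp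
  have "def_depth 2 (graph_of V S) \<le> enat ((k + 1) + 2)"
  proof (rule def_depth_le_of_definable_vertices[where \<psi>=\<psi> and T=T])
    show "pair_graph (graph_of V S)" using V S by (rule pair_graph_graph_of)
    show "sat H e (\<psi> s x) \<longleftrightarrow> T H x (e s)" if "s < 2" for H :: "nat pair_pre_digraph" and e s x
    proof -
      have "sat H (e(2 := w)) (?\<phi> y) \<longleftrightarrow> sat H (\<lambda>_. w) (?\<phi> y)" for w y
        using \<phi>[of H "e(2 := w)" y] by simp
      then show ?thesis using that by (simp add: \<psi>_def T_def ys)
    qed
    show "T (graph_of V S) x v \<longleftrightarrow> v = x"
      if "x \<in> pverts (graph_of V S)" "v \<in> pverts (graph_of V S)" for x v
    proof -
      have "T (graph_of V S) x v \<longleftrightarrow>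
          (\<forall>y\<in>Y. (y = v \<longleftrightarrow> y = x) \<and> ({y, v} \<in> S \<longleftrightarrow> {y, x} \<in> S))"
        unfolding T_def using \<phi>1 Y by auto
      also have "\<dots> \<longleftrightarrow> v = x"
      proof
        assume *: "\<forall>y\<in>Y. (y = v \<longleftrightarrow> y = x) \<and> ({y, v} \<in> S \<longleftrightarrow> {y, x} \<in> S)"
        show "v = x"
        proof (cases "x \<in> Y \<or> v \<in> Y")
          case False
          have "{x, y} \<in> S \<longleftrightarrow> {v, y} \<in> S" if "y \<in> Y" for y
            using * that by (metis insert_commute)
          then show ?thesis
            using sep False that unfolding separates_def by auto
        qed (use * in auto)
      qed auto
      finally show ?thesis .
    qed
    show "fv (\<psi> s x) \<subseteq> {s}" if "s < 2" for s x
    proof -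
      have "fv (?\<phi> y) - {2} = {}" for y
        using fv_pin_formula[of S k "\<alpha> y"] by auto
      then show ?thesis by (auto simp: \<psi>_def)
    qed
    have "sigma2 (Ex 2 (Conj (?\<phi> y) (atomic_type (y = x) ({y, x} \<in> S) 2 s)))" for y x s
      by (intro sigma2_Ex sigma2_Conj sigma2_pin_formula sigma2_qfree qdepth_atomic_type)
    then show "sigma2 (\<psi> s x)" if "s < 2" for s x
      unfolding \<psi>_def by (intro sigma2_foldr_Conj) (auto simp: sigma2_qfree)
    show "qdepth (\<psi> s x) \<le> k + 1" if "s < 2" for s x
      using qdepth_pin_formula[OF k] by (auto simp: \<psi>_def)
  qed
  then show ?thesis by (simp add: numeral_3_eq_3)
qed

section \<open>Densities of edge-set properties\<close>

text \<open>The expectation over a uniformly random subset of \<open>P\<close>, written as a finite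
  sum; \<open>dens\<close> is the matching probability.\<close>

definition avg :: "'a set \<Rightarrow> ('a set \<Rightarrow> real) \<Rightarrow> real" where
  "avg P f = (\<Sum>S\<in>Pow P. f S) / 2 ^ card P"

definition dens :: "'a set \<Rightarrow> ('a set \<Rightarrow> bool) \<Rightarrow> real" where
  "dens P Q = avg P (\<lambda>S. of_bool (Q S))"

lemma dens_eq_card: "finite P \<Longrightarrow> dens P Q = card {S \<in> Pow P. Q S} / 2 ^ card P"
proof -
  assume "finite P"
  then have "(\<Sum>S\<in>Pow P. of_bool (Q S)) = real (card {S \<in> Pow P. Q S})"
    by (simp add: of_bool_def sum.If_cases Int_def)
  then show ?thesis by (simp add: dens_def avg_def)
qed

lemma avg_cong: "(\<And>S. S \<subseteq> P \<Longrightarrow> f S = g S) \<Longrightarrow> avg P f = avg P g"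
  by (simp add: avg_def)

lemma dens_cong: "(\<And>S. S \<subseteq> P \<Longrightarrow> Q S \<longleftrightarrow> R S) \<Longrightarrow> dens P Q = dens P R"
  unfolding dens_def by (rule avg_cong) simp

lemma avg_mono: "(\<And>S. S \<subseteq> P \<Longrightarrow> f S \<le> g S) \<Longrightarrow> avg P f \<le> avg P g"
  unfolding avg_def by (intro divide_right_mono sum_mono) auto

lemma dens_mono: "(\<And>S. S \<subseteq> P \<Longrightarrow> Q S \<Longrightarrow> R S) \<Longrightarrow> dens P Q \<le> dens P R"
  unfolding dens_def by (intro avg_mono) auto

lemma avg_const [simp]: "finite P \<Longrightarrow> avg P (\<lambda>_. c) = c"
  by (simp add: avg_def card_Pow)

lemma avg_add: "avg P (\<lambda>S. f S + g S) = avg P f + avg P g"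
  by (simp add: avg_def sum.distrib add_divide_distrib)

lemma avg_diff: "avg P (\<lambda>S. f S - g S) = avg P f - avg P g"
  by (simp add: avg_def sum_subtractf diff_divide_distrib)

lemma avg_cmult: "avg P (\<lambda>S. c * f S) = c * avg P f"
  by (simp add: avg_def sum_distrib_left)

lemma avg_sum: "avg P (\<lambda>S. \<Sum>i\<in>I. f i S) = (\<Sum>i\<in>I. avg P (f i))"
  unfolding avg_def by (subst sum.swap) (simp add: sum_divide_distrib)

lemma avg_nonneg: "(\<And>S. S \<subseteq> P \<Longrightarrow> 0 \<le> f S) \<Longrightarrow> 0 \<le> avg P f"
  unfolding avg_def by (intro divide_nonneg_nonneg sum_nonneg) auto

lemma dens_nonneg [simp]: "0 \<le> dens P Q"
  unfolding dens_def by (rule avg_nonneg) simp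

lemma dens_not: "finite P \<Longrightarrow> dens P (\<lambda>S. \<not> Q S) = 1 - dens P Q"
  by (simp add: dens_def of_bool_not_iff avg_diff)

lemma dens_disj_le: "dens P (\<lambda>S. Q S \<or> R S) \<le> dens P Q + dens P R"
  unfolding dens_def avg_add[symmetric] by (rule avg_mono) auto

lemma dens_Bex_le: "finite I \<Longrightarrow> dens P (\<lambda>S. \<exists>i\<in>I. Q i S) \<le> (\<Sum>i\<in>I. dens P (Q i))"
proof (induction rule: finite_induct)
  case empty
  then show ?case by (simp add: dens_def avg_def)
next
  case (insert j I)
  have "dens P (\<lambda>S. \<exists>i\<in>insert j I. Q i S) \<le> dens P (Q j) + dens P (\<lambda>S. \<exists>i\<in>I. Q i S)"
    using dens_disj_le[of P "Q j"] by simp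
  then show ?case using insert by simp
qed

lemma avg_card: "finite I \<Longrightarrow> avg P (\<lambda>S. real (card {i \<in> I. Q i S})) = (\<Sum>i\<in>I. dens P (Q i))"
  by (simp add: dens_def avg_sum[symmetric] of_bool_def sum.If_cases Int_def)

section \<open>First and second moment inequalities\<close>

lemma dens_markov:
  assumes "c > 0" "\<And>S. S \<subseteq> P \<Longrightarrow> 0 \<le> f S"
  shows "dens P (\<lambda>S. c \<le> f S) \<le> avg P f / c"
proof -
  have "c * dens P (\<lambda>S. c \<le> f S) \<le> avg P f"
    unfolding dens_def avg_cmult[symmetric] using assms by (intro avg_mono) auto
  then show ?thesis using assms(1) by (simp add: field_simps)
qed

text \<open>Chebyshev: the hypothesis bounds the variance by \<open>\<eta> * \<mu>\<^sup>2\<close>,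
  and a value at most \<open>\<mu> / 2\<close> deviates by at least \<open>\<mu> / 2\<close>, whence
  the factor 4.\<close>

lemma second_moment:
  assumes "finite P" "finite I" and \<mu>: "\<mu> = (\<Sum>i\<in>I. dens P (Q i))" "\<mu> > 0"
    and var: "(\<Sum>i\<in>I. \<Sum>j\<in>I. dens P (\<lambda>S. Q i S \<and> Q j S)) \<le> (1 + \<eta>) * \<mu>\<^sup>2"
  shows "dens P (\<lambda>S. real (card {i \<in> I. Q i S}) \<le> \<mu> / 2) \<le> 4 * \<eta>"
proof -
  define X where "X = (\<lambda>S. real (card {i \<in> I. Q i S}))"
  have X: "X S = (\<Sum>i\<in>I. of_bool (Q i S))" for S
    using assms(2) by (simp add: X_def of_bool_def sum.If_cases Int_def)
  have EX: "avg P X = \<mu>" unfolding X_def \<mu> using assms(2) by (rule avg_card)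
  have "avg P (\<lambda>S. X S * X S) = (\<Sum>i\<in>I. \<Sum>j\<in>I. dens P (\<lambda>S. Q i S \<and> Q j S))"
    unfolding X sum_product dens_def avg_sum by (simp add: of_bool_conj)
  then have EX2: "avg P (\<lambda>S. X S * X S) \<le> (1 + \<eta>) * \<mu>\<^sup>2" using var by simp
  have "dens P (\<lambda>S. X S \<le> \<mu> / 2) \<le> dens P (\<lambda>S. (\<mu> / 2)\<^sup>2 \<le> (X S - \<mu>)\<^sup>2)"
  proof (rule dens_mono)
    fix S assume "X S \<le> \<mu> / 2"
    then have "\<mu> / 2 \<le> \<mu> - X S" by simp
    then have "(\<mu> / 2)\<^sup>2 \<le> (\<mu> - X S)\<^sup>2" using \<mu>(2) by (intro power_mono) auto
    then show "(\<mu> / 2)\<^sup>2 \<le> (X S - \<mu>)\<^sup>2" by (simp add: power2_commute)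
  qed
  also have "\<dots> \<le> avg P (\<lambda>S. (X S - \<mu>)\<^sup>2) / (\<mu> / 2)\<^sup>2"
    using \<mu>(2) by (intro dens_markov) auto
  also have "avg P (\<lambda>S. (X S - \<mu>)\<^sup>2) = avg P (\<lambda>S. X S * X S - 2 * \<mu> * X S + \<mu>\<^sup>2)"
    by (simp add: power2_diff power2_eq_square algebra_simps)
  also have "\<dots> = avg P (\<lambda>S. X S * X S) - 2 * \<mu> * \<mu> + \<mu>\<^sup>2"
    unfolding avg_add avg_diff avg_cmult EX using assms(1) by simp
  also have "\<dots> \<le> \<eta> * \<mu>\<^sup>2" using EX2 by (simp add: algebra_simps power2_eq_square)
  finally show ?thesis
    using \<mu>(2) by (simp add: X_def field_simps power2_eq_square)
qed

section \<open>Independence over disjoint edge sets\<close>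

lemma avg_Un:
  assumes "finite P1" "finite P2" "P1 \<inter> P2 = {}"
  shows "avg (P1 \<union> P2) (\<lambda>S. f (S \<inter> P1) * g (S \<inter> P2)) = avg P1 f * avg P2 g"
proof -
  \<comment> \<open>A subset of a disjoint union is the same as the pair of its traces; this
    bijection is all that independence amounts to.\<close>
  have "(\<Sum>S\<in>Pow (P1 \<union> P2). f (S \<inter> P1) * g (S \<inter> P2)) =
      (\<Sum>(S, T)\<in>Pow P1 \<times> Pow P2. f S * g T)"
    by (rule sum.reindex_bij_witness[where i="\<lambda>(S, T). S \<union> T" and j="\<lambda>S. (S \<inter> P1, S \<inter> P2)"])
      (use assms(3) in \<open>auto intro!: arg_cong2[where f="\<lambda>x y. f x * g y"]\<close>)
  also have "\<dots> = (\<Sum>S\<in>Pow P1. f S) * (\<Sum>T\<in>Pow P2. g T)"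
    by (simp add: sum_product sum.cartesian_product)
  finally show ?thesis
    using assms by (simp add: avg_def card_Un_disjoint power_add)
qed

lemma avg_local:
  assumes "finite P" "P1 \<subseteq> P"
  shows "avg P (\<lambda>S. f (S \<inter> P1)) = avg P1 f"
proof -
  have "avg (P1 \<union> (P - P1)) (\<lambda>S. f (S \<inter> P1) * 1) = avg P1 f * avg (P - P1) (\<lambda>_. 1)"
    using assms finite_subset by (intro avg_Un) auto
  then show ?thesis using assms by (simp add: Un_absorb1)
qed

lemma avg_UN:
  assumes "finite I" "\<And>i. i \<in> I \<Longrightarrow> finite (P i)" "disjoint_family_on P I"
  shows "avg (\<Union>i\<in>I. P i) (\<lambda>S. \<Prod>i\<in>I. f i (S \<inter> P i)) = (\<Prod>i\<in>I. avg (P i) (f i))"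
  using assms
proof (induction rule: finite_induct)
  case empty
  then show ?case by (simp add: avg_def)
next
  case (insert j I)
  let ?U = "\<Union>i\<in>I. P i"
  have disj: "P j \<inter> ?U = {}"
    using insert.prems(2) insert.hyps(2) by (auto simp: disjoint_family_on_def)
  have "avg (P j \<union> ?U) (\<lambda>S. f j (S \<inter> P j) * (\<Prod>i\<in>I. f i (S \<inter> ?U \<inter> P i))) =
      avg (P j) (f j) * avg ?U (\<lambda>S. \<Prod>i\<in>I. f i (S \<inter> P i))"
    using avg_Un[of "P j" ?U "f j" "\<lambda>S. \<Prod>i\<in>I. f i (S \<inter> P i)"] insert disj by simp
  moreover have "S \<inter> ?U \<inter> P i = S \<inter> P i" if "i \<in> I" for S i using that by auto
  moreover have "disjoint_family_on P I"
    using insert.prems(2) by (auto simp: disjoint_family_on_def)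
  ultimately show ?case using insert by simp
qed

lemma of_bool_Ball: "finite I \<Longrightarrow> of_bool (\<forall>i\<in>I. Q i) = (\<Prod>i\<in>I. of_bool (Q i) :: real)"
  by (induction rule: finite_induct) (auto simp: of_bool_conj)

lemma dens_UN:
  assumes "finite I" "\<And>i. i \<in> I \<Longrightarrow> finite (P i)" "disjoint_family_on P I"
  shows "dens (\<Union>i\<in>I. P i) (\<lambda>S. \<forall>i\<in>I. Q i (S \<inter> P i)) = (\<Prod>i\<in>I. dens (P i) (Q i))"
  unfolding dens_def of_bool_Ball[OF assms(1)]
  using avg_UN[OF assms, of "\<lambda>i S. of_bool (Q i S)"] by simp

lemma dens_local:
  assumes "finite P" "P1 \<subseteq> P"
  shows "dens P (\<lambda>S. Q (S \<inter> P1)) = dens P1 Q"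
  using avg_local[OF assms, of "\<lambda>S. of_bool (Q S)"] by (simp add: dens_def)

lemma dens_avoid:
  assumes "finite P" "X \<subseteq> P"
  shows "dens P (\<lambda>S. S \<inter> X = {}) = 1 / 2 ^ card X"
proof -
  have "finite X" using assms finite_subset by auto
  then have "dens X (\<lambda>S. S = {}) = 1 / 2 ^ card X"
    by (simp add: dens_def avg_def of_bool_def sum.If_cases)
  then show ?thesis using dens_local[OF assms, of "\<lambda>S. S = {}"] by simp
qed

lemma dens_hit_two:
  assumes "finite P" "X \<subseteq> P" "Y \<subseteq> P"
  shows "dens P (\<lambda>S. S \<inter> X \<noteq> {} \<and> S \<inter> Y \<noteq> {}) =
    1 - 1 / 2 ^ card X - 1 / 2 ^ card Y + 1 / 2 ^ card (X \<union> Y)"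
proof -
  have "dens P (\<lambda>S. S \<inter> X \<noteq> {} \<and> S \<inter> Y \<noteq> {}) = avg P (\<lambda>S. 1 - of_bool (S \<inter> X = {})
      - of_bool (S \<inter> Y = {}) + of_bool (S \<inter> (X \<union> Y) = {}))"
    unfolding dens_def by (rule avg_cong) (auto simp: of_bool_def Int_Un_distrib)
  also have "\<dots> = 1 - dens P (\<lambda>S. S \<inter> X = {}) - dens P (\<lambda>S. S \<inter> Y = {}) + dens P (\<lambda>S. S \<inter> (X \<union> Y) = {})"
    using assms(1) by (simp add: avg_add avg_diff dens_def)
  finally show ?thesis using assms by (simp add: dens_avoid)
qed

text \<open>Each membership in the range of g is determined by the rest of the random set.\<close>
lemma dens_match_le:
  assumes "finite P" "inj_on g I" "g ` I \<subseteq> P" "g ` I \<inter> h ` I = {}"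
  shows "dens P (\<lambda>S. \<forall>i\<in>I. g i \<in> S \<longleftrightarrow> h i \<in> S) \<le> 1 / 2 ^ card I"
proof -
  let ?F = "{S \<in> Pow P. \<forall>i\<in>I. g i \<in> S \<longleftrightarrow> h i \<in> S}"
  have "inj_on (\<lambda>S. S - g ` I) ?F"
  proof (rule inj_onI, rule set_eqI)
    fix S T x assume *: "S \<in> ?F" "T \<in> ?F" "S - g ` I = T - g ` I"
    show "x \<in> S \<longleftrightarrow> x \<in> T"
    proof (cases "x \<in> g ` I")
      case True
      then obtain i where i: "i \<in> I" "x = g i" by blast
      moreover have "h i \<notin> g ` I" using assms(4) i by auto
      ultimately show ?thesis using * by blast
    qed (use *(3) in blast)
  qed
  moreover have "(\<lambda>S. S - g ` I) ` ?F \<subseteq> Pow (P - g ` I)" by auto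
  ultimately have "card ?F \<le> card (Pow (P - g ` I))"
    using assms(1) by (intro card_inj_on_le[of "\<lambda>S. S - g ` I"]) auto
  also have "\<dots> = 2 ^ (card P - card I)"
    using assms by (simp add: card_Pow card_Diff_subset card_image finite_subset)
  finally have "real (card ?F) \<le> 2 ^ (card P - card I)" by (simp add: of_nat_le_iff[symmetric] del: of_nat_le_iff)
  moreover have "card I \<le> card P"
    using card_mono[OF assms(1,3)] assms(2) by (simp add: card_image)
  ultimately show ?thesis
    using assms(1) by (simp add: dens_eq_card field_simps power_diff)
qed

text \<open>Joining x to f x gives a graph of degree at most 2. By maximality of \<open>N\<close>,
  every x in \<open>M\<close> lies in \<open>N\<close>, in its preimage or in its image, and each of
  these has at most \<open>card N\<close> elements.\<close>

lemma large_independent_subset: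
  assumes "finite M" "inj_on f M" "\<And>x. x \<in> M \<Longrightarrow> f x \<noteq> x"
  obtains M' where "M' \<subseteq> M" "f ` M' \<inter> M' = {}" "card M \<le> 3 * card M'"
proof -
  let ?Z = "{N. N \<subseteq> M \<and> f ` N \<inter> N = {}}"
  have "finite ?Z" and "{} \<in> ?Z" using assms(1) by auto
  from finite_has_maximal2[OF this] obtain N where N: "N \<in> ?Z"
    and max: "\<forall>N'\<in>?Z. N \<subseteq> N' \<longrightarrow> N = N'"
    by (elim bexE conjE)
  have fin: "finite N" using N assms(1) finite_subset by auto
  have "M \<subseteq> N \<union> {x \<in> M. f x \<in> N} \<union> f ` N"
  proof
    fix x assume x: "x \<in> M"
    show "x \<in> N \<union> {x \<in> M. f x \<in> N} \<union> f ` N"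
    proof (rule ccontr)
      assume *: "x \<notin> N \<union> {x \<in> M. f x \<in> N} \<union> f ` N"
      then have "insert x N \<in> ?Z" using N x assms(3) by auto
      then have "N = insert x N" using max by blast
      then show False using * by blast
    qed
  qed
  then have "card M \<le> card (N \<union> {x \<in> M. f x \<in> N} \<union> f ` N)"
    using fin assms(1) by (intro card_mono) auto
  also have "\<dots> \<le> card N + card {x \<in> M. f x \<in> N} + card (f ` N)"
    by (rule order.trans[OF card_Un_le add_right_mono[OF card_Un_le]])
  also have "card (f ` N) \<le> card N" using fin by (rule card_image_le)
  also have "card {x \<in> M. f x \<in> N} \<le> card N"
    using assms(2) fin by (intro card_inj_on_le[of f]) (auto intro: inj_on_subset)
  finally show ?thesis using N that by auto
qed

section \<open>Stars of outside vertices and domination probabilities\<close>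

definition star :: "'a \<Rightarrow> 'a set \<Rightarrow> 'a set set" where
  "star z A = (\<lambda>a. {z, a}) ` A"

lemma finite_star [simp]: "finite A \<Longrightarrow> finite (star z A)"
  by (simp add: star_def)

lemma card_star: "card (star z A) = card A"
  unfolding star_def by (rule card_image) (auto simp: inj_on_def doubleton_eq_iff)

lemma star_Un: "star z (A \<union> B) = star z A \<union> star z B"
  by (auto simp: star_def)

lemma star_mono: "A \<subseteq> B \<Longrightarrow> star z A \<subseteq> star z B"
  by (auto simp: star_def)

lemma dens_Un:
  assumes "finite P1" "finite P2" "P1 \<inter> P2 = {}"
  shows "dens (P1 \<union> P2) (\<lambda>S. Q (S \<inter> P1) \<and> R (S \<inter> P2)) = dens P1 Q * dens P2 R"
  using avg_Un[OF assms, of "\<lambda>S. of_bool (Q S)" "\<lambda>S. of_bool (R S)"]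
  by (simp add: dens_def of_bool_conj)

text \<open>The edges inside C and the stars from distinct outside vertices are pairwise disjoint
  edge sets, hence independent; all remaining edges average out.\<close>

lemma dens_stars:
  assumes V: "finite V" and C: "C \<subseteq> V"
  shows "dens (pairs V) (\<lambda>S. R (S \<inter> pairs C) \<and> (\<forall>z\<in>V - C. F z (S \<inter> star z C))) =
    dens (pairs C) R * (\<Prod>z\<in>V - C. dens (star z C) (F z))"
proof -
  let ?U = "\<Union>z\<in>V - C. star z C"
  have "finite C" using V C finite_subset by auto
  then have fin: "finite C" "finite ?U" using V by auto
  have disj: "pairs C \<inter> ?U = {}" by (auto simp: pairs_def star_def)
  have "disjoint_family_on (\<lambda>z. star z C) (V - C)"
    by (auto simp: disjoint_family_on_def star_def doubleton_eq_iff)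
  then have U: "dens ?U (\<lambda>S. \<forall>z\<in>V - C. F z (S \<inter> star z C)) = (\<Prod>z\<in>V - C. dens (star z C) (F z))"
    using V fin by (intro dens_UN) auto
  have sub: "pairs C \<union> ?U \<subseteq> pairs V"
    using C by (auto simp: star_def pairs_def card_2_iff)
  let ?Q = "\<lambda>S. R (S \<inter> pairs C) \<and> (\<forall>z\<in>V - C. F z (S \<inter> ?U \<inter> star z C))"
  have "dens (pairs V) (\<lambda>S. R (S \<inter> pairs C) \<and> (\<forall>z\<in>V - C. F z (S \<inter> star z C))) =
      dens (pairs V) (\<lambda>S. ?Q (S \<inter> (pairs C \<union> ?U)))"
  proof (rule dens_cong)
    fix S
    have "S \<inter> (pairs C \<union> ?U) \<inter> ?U \<inter> star z C = S \<inter> star z C" if "z \<in> V - C" for z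
      using that by auto
    moreover have "S \<inter> (pairs C \<union> ?U) \<inter> pairs C = S \<inter> pairs C" by auto
    ultimately show "(R (S \<inter> pairs C) \<and> (\<forall>z\<in>V - C. F z (S \<inter> star z C))) \<longleftrightarrow> ?Q (S \<inter> (pairs C \<union> ?U))"
      by simp
  qed
  also have "\<dots> = dens (pairs C \<union> ?U) ?Q"
    using V sub by (intro dens_local) auto
  also have "\<dots> = dens (pairs C) R * dens ?U (\<lambda>S. \<forall>z\<in>V - C. F z (S \<inter> star z C))"
    using fin disj by (intro dens_Un) auto
  finally show ?thesis unfolding U .
qed

lemma dominates_iff_star:
  "A \<subseteq> C \<Longrightarrow> (\<exists>a\<in>A. {z, a} \<in> S) \<longleftrightarrow> S \<inter> star z C \<inter> star z A \<noteq> {}"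
  by (auto simp: star_def)

lemma dens_dominates:
  assumes "finite V" "A \<subseteq> V"
  shows "dens (pairs V) (\<lambda>S. dominates V S A) = (1 - 1 / 2 ^ card A) ^ (card V - card A)"
proof -
  have fin: "finite A" using assms finite_subset by auto
  have "dens (pairs V) (\<lambda>S. dominates V S A) =
      dens (pairs V) (\<lambda>S. True \<and> (\<forall>z\<in>V - A. S \<inter> star z A \<inter> star z A \<noteq> {}))"
    unfolding dominates_def by (rule dens_cong) (simp add: dominates_iff_star[of A A])
  also have "\<dots> = dens (pairs A) (\<lambda>_. True) *
      (\<Prod>z\<in>V - A. dens (star z A) (\<lambda>S. S \<inter> star z A \<noteq> {}))"
    by (rule dens_stars[OF assms, where R="\<lambda>_. True" and F="\<lambda>z S. S \<inter> star z A \<noteq> {}"])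
  also have "(\<lambda>z. dens (star z A) (\<lambda>S. S \<inter> star z A \<noteq> {})) = (\<lambda>_. 1 - 1 / 2 ^ card A)"
    using dens_hit_two[of "star z A" "star z A" "star z A" for z] fin by (simp add: card_star)
  finally show ?thesis
    using assms fin by (simp add: dens_def card_Diff_subset)
qed

text \<open>Only an upper bound: that B dominates A - B, and A dominates B - A, is dropped. What is
  kept about domination uses edges leaving A \<union> B, independent of the condition
  \<open>R\<close> inside it.\<close>

lemma dens_dominates_two:
  assumes "finite V" "A \<subseteq> V" "B \<subseteq> V"
  shows "dens (pairs V) (\<lambda>S. dominates V S A \<and> dominates V S B \<and> R (S \<inter> pairs (A \<union> B))) \<le>
    (1 - 1 / 2 ^ card A - 1 / 2 ^ card B + 1 / 2 ^ card (A \<union> B)) ^ (card V - card (A \<union> B)) *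
    dens (pairs (A \<union> B)) R"
proof -
  let ?C = "A \<union> B"
  have C: "?C \<subseteq> V" "finite ?C" using assms finite_subset by auto
  have "dens (pairs V) (\<lambda>S. dominates V S A \<and> dominates V S B \<and> R (S \<inter> pairs ?C)) \<le>
      dens (pairs V) (\<lambda>S. R (S \<inter> pairs ?C) \<and>
        (\<forall>z\<in>V - ?C. S \<inter> star z ?C \<inter> star z A \<noteq> {} \<and> S \<inter> star z ?C \<inter> star z B \<noteq> {}))"
    unfolding dominates_def by (rule dens_mono) (auto simp: dominates_iff_star[of _ ?C])
  also have "\<dots> = dens (pairs ?C) R * (\<Prod>z\<in>V - ?C. dens (star z ?C)
      (\<lambda>S. S \<inter> star z A \<noteq> {} \<and> S \<inter> star z B \<noteq> {}))"
    using dens_stars[OF assms(1) C(1), where R=R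
        and F="\<lambda>z S. S \<inter> star z A \<noteq> {} \<and> S \<inter> star z B \<noteq> {}"] by simp
  also have "(\<lambda>z. dens (star z ?C) (\<lambda>S. S \<inter> star z A \<noteq> {} \<and> S \<inter> star z B \<noteq> {})) =
      (\<lambda>_. 1 - 1 / 2 ^ card A - 1 / 2 ^ card B + 1 / 2 ^ card ?C)"
    using C(2) by (subst dens_hit_two) (auto simp: star_mono card_star simp flip: star_Un)
  finally show ?thesis
    using C by (simp add: card_Diff_subset mult.commute)
qed

text \<open>
  A moved index p and any other index q with \<open>a q \<noteq> b p\<close> give an edge that b
  moves, so the agreement of the two patterns involves at least t (k - 2) / 2 pairs of distinct edges,
  a third of which can be decoupled.
\<close>
lemma dens_same_pattern_le:
  assumes C: "finite C" "a ` {..<k} \<subseteq> C" "b ` {..<k} \<subseteq> C"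
    and a: "inj_on a {..<k}" and b: "inj_on b {..<k}"
  obtains m where "card {p. p < k \<and> a p \<noteq> b p} * (k - 2) \<le> 6 * m"
    "dens (pairs C) (\<lambda>S. same_pattern k S a b) \<le> 1 / 2 ^ m"
proof -
  \<comment> \<open>The vertex map a p to b p. Equal patterns mean that an edge inside the tuple and
    its image under g are both present or both absent.\<close>
  define g where "g = b \<circ> the_inv_into {..<k} a"
  have g: "g (a p) = b p" if "p < k" for p
    using that a by (simp add: g_def the_inv_into_f_f)
  have "inj_on g (a ` {..<k})"
    using b by (auto simp: inj_on_def g)
  define A where "A = pairs (a ` {..<k})"
  have A: "\<exists>p<k. \<exists>q<k. e = {a p, a q}" if "e \<in> A" for e
    using that by (auto simp: A_def pairs_def card_2_iff) blast
  have finA: "finite A" by (simp add: A_def)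
  have inj: "inj_on ((`) g) A"
    using \<open>inj_on g (a ` {..<k})\<close> 
    by (intro inj_on_image inj_on_subset[of g "a ` {..<k}" "\<Union> A"]) (auto simp: A_def pairs_def)
  define M where "M = {e \<in> A. g ` e \<noteq> e}"
  obtain M' where M': "M' \<subseteq> M" "(`) g ` M' \<inter> M' = {}" "card M \<le> 3 * card M'"
    by (rule large_independent_subset[of M "(`) g"])
      (use finA inj in \<open>auto simp: M_def intro: inj_on_subset\<close>)
  define T where "T = {p. p < k \<and> a p \<noteq> b p}"
  \<comment> \<open>For such p and q, the vertex b p belongs to the image of {a p, a q} but not to
    {a p, a q}, so this edge is moved.\<close>
  define O' where "O' = (SIGMA p:T. {q. q < k \<and> q \<noteq> p \<and> a q \<noteq> b p})"
  have "k - 2 \<le> card {q. q < k \<and> q \<noteq> p \<and> a q \<noteq> b p}" for p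
  proof -
    have "{..<k} \<subseteq> {q. q < k \<and> q \<noteq> p \<and> a q \<noteq> b p} \<union> {p} \<union> {q. q < k \<and> a q = b p}" by auto
    then have "card {..<k} \<le> card ({q. q < k \<and> q \<noteq> p \<and> a q \<noteq> b p} \<union> {p} \<union> {q. q < k \<and> a q = b p})"
      by (intro card_mono) auto
    also have "\<dots> \<le> card {q. q < k \<and> q \<noteq> p \<and> a q \<noteq> b p} + card {p} + card {q. q < k \<and> a q = b p}"
      by (rule order.trans[OF card_Un_le add_right_mono[OF card_Un_le]])
    also have "card {q. q < k \<and> a q = b p} \<le> 1"
      using a by (auto simp: card_le_Suc0_iff_eq inj_on_def)
    finally show ?thesis by simp
  qed
  then have "card T * (k - 2) \<le> card O'"
    unfolding O'_def by (subst card_SigmaI) (auto simp: T_def intro: sum_bounded_below[of T "k - 2", simplified])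
  \<comment> \<open>An ordered pair is recovered from its edge and one bit of orientation. This
    factor 2 and the 3 lost in decoupling make the 6.\<close>
  also have "card O' \<le> card (M \<times> (UNIV :: bool set))"
  proof (rule card_inj_on_le)
    show "inj_on (\<lambda>(p, q). ({a p, a q}, p < q)) O'"
    proof (rule inj_onI, clarify)
      fix p q p' q' assume *: "(p, q) \<in> O'" "(p', q') \<in> O'" "{a p, a q} = {a p', a q'}" "(p < q) = (p' < q')"
      then have lt: "p < k" "q < k" "p' < k" "q' < k" "p \<noteq> q" "p' \<noteq> q'" by (auto simp: O'_def T_def)
      then have "a p = a p' \<and> a q = a q' \<or> a p = a q' \<and> a q = a p'"
        using *(3) by (simp add: doubleton_eq_iff)
      then have "p = p' \<and> q = q' \<or> p = q' \<and> q = p'"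
        using a lt by (simp add: inj_on_eq_iff)
      then show "p = p' \<and> q = q'" using *(4) lt by auto
    qed
    show "(\<lambda>(p, q). ({a p, a q}, p < q)) ` O' \<subseteq> M \<times> UNIV"
    proof
      fix x assume "x \<in> (\<lambda>(p, q). ({a p, a q}, p < q)) ` O'"
      then obtain p q where pq: "(p, q) \<in> O'" "x = ({a p, a q}, p < q)" by auto
      then have *: "p < k" "q < k" "q \<noteq> p" "a p \<noteq> b p" "a q \<noteq> b p" by (auto simp: O'_def T_def)
      then have "{a p, a q} \<in> A" using a by (auto simp: A_def inj_on_eq_iff)
      moreover have "g ` {a p, a q} \<noteq> {a p, a q}"
        using * by (simp add: g doubleton_eq_iff)
      ultimately show "x \<in> M \<times> UNIV" using pq by (simp add: M_def)
    qed
    show "finite (M \<times> (UNIV :: bool set))" using finA by (simp add: M_def)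
  qed
  also have "\<dots> = 2 * card M" by (simp add: card_cartesian_product)
  finally have "card T * (k - 2) \<le> 6 * card M'" using M'(3) by simp
  moreover have "dens (pairs C) (\<lambda>S. same_pattern k S a b) \<le> 1 / 2 ^ card M'"
  proof -
    have "dens (pairs C) (\<lambda>S. same_pattern k S a b) \<le>
        dens (pairs C) (\<lambda>S. \<forall>e\<in>M'. e \<in> S \<longleftrightarrow> g ` e \<in> S)"
    proof (rule dens_mono, rule ballI)
      fix S e assume S: "same_pattern k S a b" and "e \<in> M'"
      then obtain p q where "p < k" "q < k" "e = {a p, a q}"
        using A[of e] M'(1) unfolding M_def by blast
      then show "e \<in> S \<longleftrightarrow> g ` e \<in> S" using S by (simp add: same_pattern_def g)
    qed
    also have "\<dots> \<le> 1 / 2 ^ card M'"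
    proof (rule dens_match_le[of "pairs C" "\<lambda>e. e" M' "(`) g"])
      show "(\<lambda>e. e) ` M' \<subseteq> pairs C"
        using M'(1) C(2) by (fastforce simp: M_def A_def pairs_def)
    qed (use C(1) M'(2) in auto)
    finally show ?thesis .
  qed
  ultimately show ?thesis using that unfolding T_def by blast
qed

text \<open>For two k-sets sharing i vertices and x = 2^i - 1, the left side is the chance that an
  outside vertex has neighbours in both. It equals (1 - q)^2 + q^2 x, the independent value plus a
  correction, and 1 / (1 - q)^2 \<le> 1 + 4 q for q \<le> 1/4.\<close>

lemma dominates_two_base_le:
  fixes q x :: real
  assumes "0 \<le> q" "q \<le> 1 / 4" "0 \<le> x"
  shows "1 - q - q + q\<^sup>2 * (1 + x) \<le> (1 - q)\<^sup>2 * exp (q\<^sup>2 * (1 + 4 * q) * x)"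
proof -
  have "(1 - q)\<^sup>2 * (1 + 4 * q) - 1 = q * (2 - 7 * q + 4 * q\<^sup>2)"
    by (simp add: power2_eq_square algebra_simps)
  also have "\<dots> \<ge> 0" using assms by (intro mult_nonneg_nonneg) auto
  finally have "1 \<le> (1 - q)\<^sup>2 * (1 + 4 * q)" by simp
  then have "q\<^sup>2 * x * 1 \<le> q\<^sup>2 * x * ((1 - q)\<^sup>2 * (1 + 4 * q))"
    using assms by (intro mult_left_mono) auto
  then have "1 - q - q + q\<^sup>2 * (1 + x) \<le> (1 - q)\<^sup>2 * (1 + q\<^sup>2 * (1 + 4 * q) * x)"
    by (simp add: power2_eq_square algebra_simps)
  also have "\<dots> \<le> (1 - q)\<^sup>2 * exp (q\<^sup>2 * (1 + 4 * q) * x)"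
    by (intro mult_left_mono exp_ge_add_one_self) auto
  finally show ?thesis .
qed

lemma dens_dominates_two_le:
  fixes q :: real
  assumes V: "finite V" "A \<subseteq> V" "B \<subseteq> V" and k: "card A = k" "card B = k" "k \<ge> 2"
    and i: "card (A \<inter> B) \<le> i" and q: "q = 1 / 2 ^ k"
  shows "dens (pairs V) (\<lambda>S. dominates V S A \<and> dominates V S B \<and> R (S \<inter> pairs (A \<union> B))) \<le>
    (1 - q) ^ (2 * (card V - 2 * k)) * exp (card V * (q\<^sup>2 * (1 + 4 * q) * (2 ^ i - 1))) *
    dens (pairs (A \<union> B)) R"
proof -
  have fin: "finite A" "finite B" using V finite_subset by auto
  have "(1/2 :: real) ^ k \<le> (1/2)^2" using k(3) by (intro power_decreasing) auto
  then have q01: "0 < q" "q \<le> 1 / 4" by (simp_all add: q power_divide power2_eq_square)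
  have un: "card (A \<union> B) + card (A \<inter> B) = k + k"
    using card_Un_Int[OF fin] k by simp
  then have le: "card (A \<union> B) \<le> 2 * k" by linarith
  have "(2::real) ^ card (A \<union> B) * 2 ^ card (A \<inter> B) = 2 ^ k * 2 ^ k"
    using un by (simp flip: power_add)
  then have "1 / 2 ^ card (A \<union> B) = q\<^sup>2 * 2 ^ card (A \<inter> B)"
    by (simp add: q field_simps power2_eq_square)
  also have "\<dots> \<le> q\<^sup>2 * (1 + (2 ^ i - 1))"
    using i by (intro mult_left_mono) (auto intro: power_increasing)
  finally have "1 - 1 / 2 ^ card A - 1 / 2 ^ card B + 1 / 2 ^ card (A \<union> B) \<le>
      1 - q - q + q\<^sup>2 * (1 + (2 ^ i - 1))" (is "?b \<le> _")
    by (simp add: k q)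
  also have "\<dots> \<le> (1 - q)\<^sup>2 * exp (q\<^sup>2 * (1 + 4 * q) * (2 ^ i - 1))"
    using q01 by (intro dominates_two_base_le) auto
  finally have b: "?b \<le> (1 - q)\<^sup>2 * exp (q\<^sup>2 * (1 + 4 * q) * (2 ^ i - 1))" .
  have "0 \<le> 1 / (2::real) ^ card (A \<union> B)" by simp
  then have b0: "0 \<le> ?b" using q01 k by (simp add: q)
  have "(1/2 :: real) ^ card (A \<union> B) \<le> (1/2) ^ card A"
    using fin by (intro power_decreasing card_mono) auto
  then have b1: "?b \<le> 1"
    by (simp add: power_divide) (smt (verit) zero_le_divide_1_iff zero_le_power)
  have "?b ^ (card V - card (A \<union> B)) \<le> ?b ^ (card V - 2 * k)"
    using b0 b1 le by (intro power_decreasing) auto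
  also have "\<dots> \<le> ((1 - q)\<^sup>2 * exp (q\<^sup>2 * (1 + 4 * q) * (2 ^ i - 1))) ^ (card V - 2 * k)"
    using b b0 by (intro power_mono)
  also have "\<dots> = (1 - q) ^ (2 * (card V - 2 * k)) *
      exp (real (card V - 2 * k) * (q\<^sup>2 * (1 + 4 * q) * (2 ^ i - 1)))"
    by (simp add: power_mult_distrib power_mult exp_of_nat_mult)
  also have "\<dots> \<le> (1 - q) ^ (2 * (card V - 2 * k)) * exp (card V * (q\<^sup>2 * (1 + 4 * q) * (2 ^ i - 1)))"
    using q01 by (intro mult_left_mono) (auto intro!: mult_right_mono)
  finally have "?b ^ (card V - card (A \<union> B)) \<le> \<dots>" .
  then show ?thesis
    using dens_dominates_two[OF V, of R] by (elim order.trans) (intro mult_right_mono dens_nonneg)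
qed

text \<open>Convexity: on 0..k the function 2^i - 1 lies below its chord. It makes the correlation
  exponent linear in the overlap, that is, a product of one factor per entry.\<close>

lemma two_power_chord: "i \<le> k \<Longrightarrow> real k * (2 ^ i - 1) \<le> real i * 2 ^ k"
proof (induction k rule: dec_induct)
  case base
  then show ?case by (simp add: mult_left_mono)
next
  case (step k)
  have "real (Suc k) * (2 ^ i - 1) \<le> real i * 2 ^ k + (2 ^ i - 1)"
    using step.IH by (simp add: algebra_simps)
  also have "2 ^ i - 1 \<le> real i * 2 ^ k"
  proof (cases "i = 0")
    case False
    have "2 ^ i \<le> (2::real) ^ k" using step.hyps(1) by (rule power_increasing) simp
    then have "2 ^ i - 1 \<le> (1::real) * 2 ^ k" by linarith
    also have "\<dots> \<le> real i * 2 ^ k" using False by (intro mult_right_mono) auto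
    finally show ?thesis .
  qed simp
  finally show ?case by simp
qed

section \<open>Moments of the number of dominating tuples\<close>

lemma one_minus_ge_exp:
  fixes q :: real
  assumes "0 \<le> q" "q \<le> 1 / 2"
  shows "exp (- 2 * q) \<le> 1 - q"
proof -
  have "1 \<le> (1 - q) * (1 + 2 * q)"
    using mult_nonneg_nonneg[of q "1 - 2 * q"] assms by (simp add: algebra_simps)
  also have "\<dots> \<le> (1 - q) * exp (2 * q)"
    using assms by (intro mult_left_mono exp_ge_add_one_self) auto
  finally show ?thesis by (simp add: exp_minus field_simps)
qed

text \<open>Disjoint blocks make every choice of entries injective, let two tuples share a vertex
  only at the same position, and turn the set of tuples into a product.\<close>

locale tuple_blocks =
  fixes V :: "'a set" and k m :: nat and y :: 'a and R :: "nat \<Rightarrow> 'a set"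
  assumes finite_V: "finite V" and k: "k \<ge> 2" and n: "card V \<ge> 4 * k" and m: "m \<ge> 1"
    and R0: "R 0 = {y}" and R_sub: "\<And>p. p < k \<Longrightarrow> R p \<subseteq> V"
    and disj: "disjoint_family_on R {..<k}"
    and card_R: "\<And>p. 0 < p \<Longrightarrow> p < k \<Longrightarrow> card (R p) = m"
begin

definition q :: real where "q = 1 / 2 ^ k"
definition tuples :: "(nat \<Rightarrow> 'a) set" where "tuples = PiE {..<k} R"
text \<open>Ranges over all of V and not just the blocks, because \<open>pins\<close> compares with
  arbitrary tuples; extensionality keeps the set finite.\<close>

definition rivals :: "(nat \<Rightarrow> 'a) set" where
  "rivals = {b \<in> PiE {..<k} (\<lambda>_. V). inj_on b {..<k} \<and> b 0 \<noteq> y}"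
definition p1 :: real where "p1 = (1 - q) ^ (card V - k)"
definition \<mu> :: real where "\<mu> = real m ^ (k - 1) * p1"
text \<open>
  \<open>\<rho>\<close> is the factor by which each further common entry raises the chance that two tuples dominate
  simultaneously. For a rival of a dominating tuple, \<open>\<alpha>\<close> is the cost of an entry
  differing from the original (pattern constraints) and \<open>\<sigma>\<close> that of an entry outside it
  (domination); s bounds the total weight of the choices for a differing entry.
\<close>
definition \<rho> :: real where "\<rho> = exp (card V * q * (1 + 4 * q) / (k - 1))"
definition \<alpha> :: real where "\<alpha> = 2 powr (- (real k - 2) / 6)"
definition \<sigma> :: real where "\<sigma> = exp (- (card V * q / k))"
definition s :: real where "s = \<alpha> * (k + card V * \<sigma>)"

lemma q: "0 < q" "q \<le> 1 / 4"
proof -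
  have "(1/2 :: real) ^ k \<le> (1/2)^2" using k by (intro power_decreasing) auto
  then show "0 < q" "q \<le> 1 / 4" by (simp_all add: q_def power_divide power2_eq_square)
qed

lemma p1_pos: "p1 > 0"
  using q by (simp add: p1_def)

lemma \<mu>_pos: "\<mu> > 0"
  using p1_pos m by (simp add: \<mu>_def)

lemma finite_R: "p < k \<Longrightarrow> finite (R p)"
  using R_sub finite_V finite_subset by blast

lemma finite_tuples: "finite tuples"
  unfolding tuples_def by (intro finite_PiE finite_R) auto

lemma finite_rivals: "finite rivals"
proof (rule finite_subset)
  show "rivals \<subseteq> PiE {..<k} (\<lambda>_. V)" by (auto simp: rivals_def)
  show "finite (PiE {..<k} (\<lambda>_. V))" using finite_V by (intro finite_PiE) auto
qed

lemma tuple_nth: "a \<in> tuples \<Longrightarrow> p < k \<Longrightarrow> a p \<in> R p"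
  by (auto simp: tuples_def)

lemma tuple_nth_0: "a \<in> tuples \<Longrightarrow> a 0 = y"
  using tuple_nth[of a 0] k R0 by auto

lemma R_unique: "v \<in> R p \<Longrightarrow> v \<in> R p' \<Longrightarrow> p < k \<Longrightarrow> p' < k \<Longrightarrow> p = p'"
  using disj by (auto simp: disjoint_family_on_def)

lemma tuple_inj: "a \<in> tuples \<Longrightarrow> inj_on a {..<k}"
  by (rule inj_onI) (metis R_unique lessThan_iff tuple_nth)

lemma tuple_image_sub: "a \<in> tuples \<Longrightarrow> a ` {..<k} \<subseteq> V"
  using tuple_nth R_sub by blast

lemma card_tuple_image: "a \<in> tuples \<Longrightarrow> card (a ` {..<k}) = k"
  using tuple_inj card_image by fastforce

lemma prod_split_0: "(\<Prod>p<k. f p) = f 0 * (\<Prod>p=1..<k. f p :: real)"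
proof -
  have "{..<k} = insert 0 {1..<k}" using k by auto
  then show ?thesis by simp
qed

lemma card_tuples: "real (card tuples) = real m ^ (k - 1)"
proof -
  have "real (card tuples) = (\<Prod>p<k. real (card (R p)))"
    unfolding tuples_def by (simp add: card_PiE)
  also have "\<dots> = real m ^ (k - 1)"
    by (simp add: prod_split_0 R0 card_R)
  finally show ?thesis .
qed

lemma dens_tuple: "a \<in> tuples \<Longrightarrow> dens (pairs V) (\<lambda>S. dominates V S (a ` {..<k})) = p1"
  using dens_dominates[OF finite_V tuple_image_sub] card_tuple_image by (simp add: p1_def q_def)

lemma expected_tuples: "(\<Sum>a\<in>tuples. dens (pairs V) (\<lambda>S. dominates V S (a ` {..<k}))) = \<mu>"
  using card_tuples by (simp add: dens_tuple \<mu>_def)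

lemma dens_two_tuples:
  assumes a: "a \<in> tuples" and b: "b \<in> tuples"
  shows "dens (pairs V) (\<lambda>S. dominates V S (a ` {..<k}) \<and> dominates V S (b ` {..<k})) \<le>
    p1\<^sup>2 * exp (4 * k * q + 2 * card V * q\<^sup>2) *
    (\<Prod>p<k. if p \<noteq> 0 \<and> b p = a p then \<rho> else 1)"
proof -
  let ?I = "{p \<in> {1..<k}. b p = a p}"
  define i where "i = card ?I"
  \<comment> \<open>A common vertex has the same position in both tuples. As y is always common, i
    further agreements give an overlap of at most \<open>Suc i\<close>.\<close>
  have "a ` {..<k} \<inter> b ` {..<k} \<subseteq> insert y (a ` ?I)"
  proof
    fix v assume "v \<in> a ` {..<k} \<inter> b ` {..<k}"
    then obtain p p' where p: "p < k" "p' < k" "v = a p" "v = b p'" by auto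
    then have "v \<in> R p" "v \<in> R p'"
      using tuple_nth[OF a, of p] tuple_nth[OF b, of p'] by simp_all
    then have "p = p'" using R_unique p by blast
    then show "v \<in> insert y (a ` ?I)"
      using p tuple_nth_0[OF a] by (cases "p = 0") auto
  qed
  then have "card (a ` {..<k} \<inter> b ` {..<k}) \<le> card (insert y (a ` ?I))"
    by (intro card_mono) auto
  also have "\<dots> \<le> Suc (card (a ` ?I))" by (rule card_insert_le_m1) auto
  also have "card (a ` ?I) \<le> i" unfolding i_def by (intro card_image_le) auto
  finally have cap: "card (a ` {..<k} \<inter> b ` {..<k}) \<le> Suc i" by simp
  have "i \<le> card {1..<k}" unfolding i_def by (intro card_mono) auto
  then have ik: "i \<le> k - 1" by simp
  have "dens (pairs V) (\<lambda>S. dominates V S (a ` {..<k}) \<and> dominates V S (b ` {..<k})) \<le>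
      (1 - q) ^ (2 * (card V - 2 * k)) * exp (card V * (q\<^sup>2 * (1 + 4 * q) * (2 ^ Suc i - 1)))"
    using dens_dominates_two_le[OF finite_V tuple_image_sub[OF a] tuple_image_sub[OF b]
        card_tuple_image[OF a] card_tuple_image[OF b] k cap q_def, of "\<lambda>_. True"] finite_V a b
      finite_subset[OF tuple_image_sub finite_V]
    by (simp add: dens_def)
  \<comment> \<open>Compared with \<open>p1\<^sup>2\<close>, 2 k factors 1 - q are missing, each at
    least exp (- 2 q).\<close>
  also have "(1 - q) ^ (2 * (card V - 2 * k)) \<le> p1\<^sup>2 * exp (4 * k * q)"
  proof -
    have "exp (- 2 * q) ^ (2 * k) \<le> (1 - q) ^ (2 * k)"
      using q by (intro power_mono one_minus_ge_exp) auto
    then have "exp (4 * k * q) * exp (- 2 * q) ^ (2 * k) \<le> exp (4 * k * q) * (1 - q) ^ (2 * k)"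
      by (rule mult_left_mono) simp
    also have "exp (4 * k * q) * exp (- 2 * q) ^ (2 * k) = 1"
      by (simp flip: exp_of_nat_mult exp_add)
    finally have "1 \<le> exp (4 * k * q) * (1 - q) ^ (2 * k)" .
    then have "(1 - q) ^ (2 * (card V - 2 * k)) * 1 \<le>
        (1 - q) ^ (2 * (card V - 2 * k)) * (exp (4 * k * q) * (1 - q) ^ (2 * k))"
      using q by (intro mult_left_mono) auto
    also have "\<dots> = exp (4 * k * q) * (1 - q) ^ (2 * (card V - 2 * k) + 2 * k)"
      by (simp add: power_add)
    also have "2 * (card V - 2 * k) + 2 * k = (card V - k) * 2" using n by simp
    also have "(1 - q) ^ ((card V - k) * 2) = p1\<^sup>2" unfolding p1_def by (rule power_mult)
    finally show ?thesis by (simp add: mult.commute)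
  qed
  \<comment> \<open>Write 2^(i+1) - 1 as 1 + 2 (2^i - 1): the 1 is due to the forced common entry y
    and costs a factor near 1, while the chord over 0..k-1 turns the rest into
    \<open>\<rho> ^ i\<close>.\<close>
  also have "exp (card V * (q\<^sup>2 * (1 + 4 * q) * (2 ^ Suc i - 1))) \<le> exp (2 * card V * q\<^sup>2) * \<rho> ^ i"
  proof -
    have k1: "real (k - 1) > 0" using k by simp
    have "real (k - 1) * (2 ^ i - 1) \<le> real i * 2 ^ (k - 1)" using ik by (rule two_power_chord)
    then have "2 ^ i - 1 \<le> real i * 2 ^ (k - 1) / real (k - 1)"
      using k1 by (simp add: field_simps)
    then have "1 + 2 * (2 ^ i - 1) \<le> 1 + 2 * (real i * 2 ^ (k - 1) / real (k - 1))"
      by (intro add_left_mono mult_left_mono) auto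
    also have "1 + 2 * (2 ^ i - 1) = 2 ^ Suc i - (1::real)" by simp
    also have "2 * (real i * 2 ^ (k - 1) / real (k - 1)) = real i * (2 * 2 ^ (k - 1)) / real (k - 1)"
      by simp
    also have "2 * (2::real) ^ (k - 1) = 2 ^ k" using k by (simp flip: power_Suc)
    finally have "2 ^ Suc i - 1 \<le> 1 + real i * 2 ^ k / real (k - 1)" .
    then have "card V * (q\<^sup>2 * (1 + 4 * q) * (2 ^ Suc i - 1)) \<le>
        card V * (q\<^sup>2 * (1 + 4 * q) * (1 + real i * 2 ^ k / real (k - 1)))"
      using q by (intro mult_left_mono) auto
    also have "\<dots> = card V * q\<^sup>2 * (1 + 4 * q) + i * (card V * q * (1 + 4 * q) / real (k - 1))"
      using k1 by (simp add: q_def field_simps power2_eq_square)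
    also have "card V * q\<^sup>2 * (1 + 4 * q) \<le> card V * q\<^sup>2 * 2"
      using q by (intro mult_left_mono) auto
    finally show ?thesis
      by (simp add: \<rho>_def algebra_simps k of_nat_diff flip: exp_of_nat_mult exp_add)
  qed
  also have "\<rho> ^ i = (\<Prod>p<k. if p \<noteq> 0 \<and> b p = a p then \<rho> else 1)"
  proof -
    have "{p. p < k \<and> p \<noteq> 0 \<and> b p = a p} = ?I" by auto
    then show ?thesis by (simp add: prod.If_cases i_def Int_def)
  qed
  finally show ?thesis
    using q by (simp add: exp_add mult_ac mult_left_mono mult_right_mono)
qed

text \<open>The sum over b is a product over positions, where a block contributes at most m +
  \<open>\<rho>\<close> instead of m. So the relative excess is controlled by k
  \<open>\<rho>\<close> / m, and this is where 5/8 < ln 2 is used.\<close>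

lemma second_moment_tuples:
  "(\<Sum>a\<in>tuples. \<Sum>b\<in>tuples.
      dens (pairs V) (\<lambda>S. dominates V S (a ` {..<k}) \<and> dominates V S (b ` {..<k})))
    \<le> exp (4 * k * q + 2 * card V * q\<^sup>2 + k * \<rho> / m) * \<mu>\<^sup>2"
proof -
  let ?K = "p1\<^sup>2 * exp (4 * k * q + 2 * card V * q\<^sup>2)"
  have \<rho>: "\<rho> > 0" by (simp add: \<rho>_def)
  have "(\<Sum>b\<in>tuples. \<Prod>p<k. if p \<noteq> 0 \<and> b p = a p then \<rho> else 1) \<le> real m ^ (k - 1) * exp (k * \<rho> / m)"
    if a: "a \<in> tuples" for a
  proof -
    have "(\<Sum>b\<in>tuples. \<Prod>p<k. if p \<noteq> 0 \<and> b p = a p then \<rho> else 1) =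
        (\<Prod>p<k. \<Sum>v\<in>R p. if p \<noteq> 0 \<and> v = a p then \<rho> else 1)"
      unfolding tuples_def by (subst prod_sum_PiE) (auto intro: finite_R)
    also have "\<dots> = (\<Prod>p=1..<k. \<Sum>v\<in>R p. if v = a p then \<rho> else 1)"
      by (simp add: prod_split_0 R0)
    also have "\<dots> \<le> (\<Prod>p=1..<k. real m + \<rho>)"
    proof (rule prod_mono)
      fix p assume p: "p \<in> {1..<k}"
      have "(\<Sum>v\<in>R p. if v = a p then \<rho> else 1) \<le> (\<Sum>v\<in>R p. 1 + (if v = a p then \<rho> else 0))"
        using \<rho> by (intro sum_mono) auto
      also have "\<dots> \<le> real m + \<rho>"
        using p \<rho> finite_R by (simp add: sum.distrib card_R)
      finally show "0 \<le> (\<Sum>v\<in>R p. if v = a p then \<rho> else 1) \<and>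
          (\<Sum>v\<in>R p. if v = a p then \<rho> else 1) \<le> real m + \<rho>"
        using \<rho> by (auto intro: sum_nonneg)
    qed
    also have "real m + \<rho> = real m * (1 + \<rho> / m)"
      using m by (simp add: distrib_left)
    also have "(\<Prod>p=1..<k. real m * (1 + \<rho> / m)) = (real m * (1 + \<rho> / m)) ^ (k - 1)"
      by simp
    also have "\<dots> = real m ^ (k - 1) * (1 + \<rho> / m) ^ (k - 1)" by (rule power_mult_distrib)
    also have "(1 + \<rho> / m) ^ (k - 1) \<le> exp (\<rho> / m) ^ (k - 1)"
      using \<rho> by (intro power_mono exp_ge_add_one_self) auto
    also have "\<dots> \<le> exp (\<rho> / m) ^ k"
      using \<rho> by (intro power_increasing) auto
    finally show ?thesis by (simp add: exp_of_nat_mult[symmetric] mult_left_mono)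
  qed
  note inner = this
  have "(\<Sum>b\<in>tuples. dens (pairs V) (\<lambda>S. dominates V S (a ` {..<k}) \<and> dominates V S (b ` {..<k})))
      \<le> ?K * (real m ^ (k - 1) * exp (k * \<rho> / m))" if "a \<in> tuples" for a
  proof -
    have "(\<Sum>b\<in>tuples. dens (pairs V) (\<lambda>S. dominates V S (a ` {..<k}) \<and> dominates V S (b ` {..<k})))
        \<le> (\<Sum>b\<in>tuples. ?K * (\<Prod>p<k. if p \<noteq> 0 \<and> b p = a p then \<rho> else 1))"
      using that by (intro sum_mono dens_two_tuples)
    also have "\<dots> \<le> ?K * (real m ^ (k - 1) * exp (k * \<rho> / m))"
      unfolding sum_distrib_left[symmetric] using inner[OF that] by (intro mult_left_mono) auto
    finally show ?thesis .
  qed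
  then have "(\<Sum>a\<in>tuples. \<Sum>b\<in>tuples.
      dens (pairs V) (\<lambda>S. dominates V S (a ` {..<k}) \<and> dominates V S (b ` {..<k})))
    \<le> real (card tuples) * (?K * (real m ^ (k - 1) * exp (k * \<rho> / m)))"
    by (rule sum_bounded_above)
  also have "\<dots> = exp (4 * k * q + 2 * card V * q\<^sup>2 + k * \<rho> / m) * \<mu>\<^sup>2"
    by (simp add: card_tuples \<mu>_def exp_add power2_eq_square)
  finally show ?thesis .
qed

text \<open>With j entries of b outside a, the chord bound gives joint domination of order p1
  \<open>\<sigma>\<close>^j. It is right at both ends: p1 for j = 0, when both tuples have the same
  vertices, and about p1^2 for j = k.\<close>

lemma dens_conflict:
  assumes a: "a \<in> tuples" and b: "b \<in> rivals"
  shows "dens (pairs V) (\<lambda>S. dominates V S (a ` {..<k}) \<and> dominates V S (b ` {..<k}) \<and>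
      same_pattern k S a b) \<le> p1 * exp (3 * k * q + 4 * card V * q\<^sup>2) *
    (\<Prod>p<k. if b p = a p then 1 else if b p \<in> a ` {..<k} then \<alpha> else \<alpha> * \<sigma>)"
proof -
  let ?A = "a ` {..<k}" and ?B = "b ` {..<k}"
  let ?J = "{p. p < k \<and> b p \<notin> ?A}" and ?T = "{p. p < k \<and> a p \<noteq> b p}"
  have inj: "inj_on b {..<k}" and sub: "?B \<subseteq> V" using b by (auto simp: rivals_def)
  have cB: "card ?B = k" using inj card_image by fastforce
  have finA: "finite (?A \<union> ?B)" by simp
  define j where "j = card ?J"
  have "b ` {..<k} \<inter> Z = b ` {p \<in> {..<k}. b p \<in> Z}" for Z by auto
  then have "?A \<inter> ?B = b ` {p \<in> {..<k}. b p \<in> ?A}" by (simp only: Int_commute)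
  also have "{p \<in> {..<k}. b p \<in> ?A} = {..<k} - ?J" by auto
  finally have "card (?A \<inter> ?B) = card (b ` ({..<k} - ?J))" by simp
  also have "\<dots> = card ({..<k} - ?J)" using inj by (intro card_image) (auto intro: inj_on_subset)
  also have "\<dots> = k - j" unfolding j_def by (subst card_Diff_subset) auto
  finally have cap: "card (?A \<inter> ?B) \<le> k - j" by simp
  have "j \<le> card {..<k}" unfolding j_def by (intro card_mono) auto
  then have jk: "j \<le> k" by simp
  obtain r where r: "card ?T * (k - 2) \<le> 6 * r"
    "dens (pairs (?A \<union> ?B)) (\<lambda>S. same_pattern k S a b) \<le> 1 / 2 ^ r"
    using dens_same_pattern_le[of "?A \<union> ?B" a k b] tuple_inj[OF a] inj finA by auto
  \<comment> \<open>\<open>same_pattern\<close> also queries the singletons {a p, a p}; they belong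
    to no subset of \<open>pairs V\<close>.\<close>
  have pat: "same_pattern k S a b \<longleftrightarrow> same_pattern k (S \<inter> pairs (?A \<union> ?B)) a b" if "S \<subseteq> pairs V" for S
  proof -
    have "{u, v} \<in> S \<longleftrightarrow> {u, v} \<in> S \<inter> pairs (?A \<union> ?B)" if "u \<in> ?A \<union> ?B" "v \<in> ?A \<union> ?B" for u v
      using that edge_endpoints[OF \<open>S \<subseteq> pairs V\<close>] by auto
    then show ?thesis by (simp add: same_pattern_def)
  qed
  have "dens (pairs V) (\<lambda>S. dominates V S ?A \<and> dominates V S ?B \<and> same_pattern k S a b) =
      dens (pairs V) (\<lambda>S. dominates V S ?A \<and> dominates V S ?B \<and>
        same_pattern k (S \<inter> pairs (?A \<union> ?B)) a b)"
    by (rule dens_cong) (use pat in blast)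
  also have "\<dots> \<le> (1 - q) ^ (2 * (card V - 2 * k)) *
      exp (card V * (q\<^sup>2 * (1 + 4 * q) * (2 ^ (k - j) - 1))) *
      dens (pairs (?A \<union> ?B)) (\<lambda>S. same_pattern k S a b)"
    by (rule dens_dominates_two_le[OF finite_V tuple_image_sub[OF a] sub card_tuple_image[OF a] cB k cap q_def])
  also have "dens (pairs (?A \<union> ?B)) (\<lambda>S. same_pattern k S a b) \<le> \<alpha> ^ card ?T"
  proof -
    have "real (card ?T) * (real k - 2) = real (card ?T * (k - 2))" using k by (simp add: of_nat_diff)
    also have "\<dots> \<le> real (6 * r)" using r(1) by (rule of_nat_mono)
    also have "\<dots> = 6 * real r" by simp
    finally have "- real r \<le> - (real k - 2) / 6 * real (card ?T)" by (simp add: field_simps)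
    then have "2 powr (- real r) \<le> 2 powr (- (real k - 2) / 6 * real (card ?T))"
      by (rule powr_mono) simp
    also have "\<dots> = \<alpha> ^ card ?T" by (simp add: \<alpha>_def powr_power mult.commute)
    finally have "1 / 2 ^ r \<le> \<alpha> ^ card ?T" by (simp add: powr_minus_divide powr_realpow)
    with r(2) show ?thesis by (rule order.trans)
  qed
  \<comment> \<open>The overlap is at most k - j, so the chord leaves the exponent n q (1 - j / k),
    up to a lower-order term.\<close>
  also have "exp (card V * (q\<^sup>2 * (1 + 4 * q) * (2 ^ (k - j) - 1))) \<le>
      exp (card V * q + 4 * card V * q\<^sup>2) * \<sigma> ^ j"
  proof -
    have k0: "real k > 0" using k by simp
    have "real k * (2 ^ (k - j) - 1) \<le> real (k - j) * 2 ^ k" by (rule two_power_chord) simp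
    then have "2 ^ (k - j) - 1 \<le> (1 - real j / k) * 2 ^ k"
      using k0 jk by (simp add: field_simps of_nat_diff)
    then have "card V * (q\<^sup>2 * (1 + 4 * q) * (2 ^ (k - j) - 1)) \<le>
        card V * (q\<^sup>2 * (1 + 4 * q) * ((1 - real j / k) * 2 ^ k))"
      using q by (intro mult_left_mono) auto
    also have "\<dots> = card V * q * (1 - real j / k) + 4 * card V * q\<^sup>2 * (1 - real j / k)"
      using k0 by (simp add: q_def field_simps power2_eq_square)
    also have "4 * card V * q\<^sup>2 * (1 - real j / k) \<le> 4 * card V * q\<^sup>2 * 1"
      using q k0 by (intro mult_left_mono) auto
    finally show ?thesis
      by (simp add: \<sigma>_def algebra_simps flip: exp_of_nat_mult exp_add)
  qed
  \<comment> \<open>Only one factor p1 is split off; the exp (- n q) from the rest cancels the exp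
    (n q) just obtained.\<close>
  also have "(1 - q) ^ (2 * (card V - 2 * k)) \<le> p1 * exp (- q * (card V - 3 * k))"
  proof -
    have "(1 - q) ^ (card V - 3 * k) \<le> exp (- q) ^ (card V - 3 * k)"
      using q exp_ge_add_one_self[of "- q"] by (intro power_mono) auto
    then have "(1 - q) ^ (card V - k) * (1 - q) ^ (card V - 3 * k) \<le> p1 * exp (- q) ^ (card V - 3 * k)"
      using p1_pos by (simp add: p1_def mult_left_mono)
    moreover have "(card V - k) + (card V - 3 * k) = 2 * (card V - 2 * k)" using n by simp
    ultimately show ?thesis
      using n by (simp add: of_nat_diff mult.commute flip: power_add exp_of_nat_mult)
  qed
  finally have "dens (pairs V) (\<lambda>S. dominates V S ?A \<and> dominates V S ?B \<and> same_pattern k S a b) \<le>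
      p1 * exp (- q * (card V - 3 * k)) * (exp (card V * q + 4 * card V * q\<^sup>2) * \<sigma> ^ j) * \<alpha> ^ card ?T"
    using p1_pos by (simp add: mult_left_mono mult_right_mono \<alpha>_def \<sigma>_def)
  also have "\<dots> = p1 * exp (3 * k * q + 4 * card V * q\<^sup>2) * (\<sigma> ^ j * \<alpha> ^ card ?T)"
    using n by (simp add: algebra_simps of_nat_diff flip: exp_add)
  also have "\<sigma> ^ j * \<alpha> ^ card ?T = (\<Prod>p<k. (if b p \<notin> ?A then \<sigma> else 1) * (if a p \<noteq> b p then \<alpha> else 1))"
    unfolding prod.distrib by (simp add: prod.If_cases j_def Int_def lessThan_def conj_commute)
  also have "\<dots> = (\<Prod>p<k. if b p = a p then 1 else if b p \<in> ?A then \<alpha> else \<alpha> * \<sigma>)"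
    by (rule prod.cong) auto
  finally show ?thesis .
qed

text \<open>The weights factor over positions: entry 0 must differ and contributes s, any other
  position at most 1 + s. The bound is relative to \<open>\<mu>\<close>, so conflicts are few
  compared with dominating tuples, however large both numbers are.\<close>

lemma expected_conflicts:
  "(\<Sum>a\<in>tuples. \<Sum>b\<in>rivals. dens (pairs V) (\<lambda>S. dominates V S (a ` {..<k}) \<and>
      dominates V S (b ` {..<k}) \<and> same_pattern k S a b))
    \<le> \<mu> * (exp (3 * k * q + 4 * card V * q\<^sup>2) * (s * exp (k * s)))"
proof -
  have pos: "\<alpha> > 0" "\<sigma> > 0" "s > 0" using k by (auto simp: \<alpha>_def \<sigma>_def s_def intro!: mult_pos_pos add_pos_nonneg)
  have "(\<Sum>b\<in>rivals. \<Prod>p<k. if b p = a p then 1 else if b p \<in> a ` {..<k} then \<alpha> else \<alpha> * \<sigma>)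
      \<le> s * exp (k * s)" if a: "a \<in> tuples" for a
  proof -
    let ?w = "\<lambda>p v. if v = a p then 1 else if v \<in> a ` {..<k} then \<alpha> else \<alpha> * \<sigma>"
    let ?D = "\<lambda>p. if p = 0 then V - {y} else V"
    have w: "?w p v \<ge> 0" for p v using pos by auto
    have off: "(\<Sum>v\<in>V - {a p}. ?w p v) \<le> s" for p
    proof -
      have "(\<Sum>v\<in>V - {a p}. ?w p v) \<le> (\<Sum>v\<in>V. (if v \<in> a ` {..<k} then \<alpha> else 0) + \<alpha> * \<sigma>)"
        using finite_V pos by (intro sum_le_included[where i="\<lambda>v. v"]) auto
      also have "\<dots> = \<alpha> * card (V \<inter> a ` {..<k}) + card V * (\<alpha> * \<sigma>)"
        using finite_V by (simp add: sum.distrib sum.If_cases)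
      also have "V \<inter> a ` {..<k} = a ` {..<k}" using tuple_image_sub[OF a] by auto
      finally show ?thesis by (simp add: card_tuple_image[OF a] s_def algebra_simps)
    qed
    \<comment> \<open>Injectivity is given up to obtain a full product; the restriction at position
      0 stays and supplies the small factor s.\<close>
    have "(\<Sum>b\<in>rivals. \<Prod>p<k. ?w p (b p)) \<le> (\<Sum>b\<in>PiE {..<k} ?D. \<Prod>p<k. ?w p (b p))"
      using w finite_V
      by (intro sum_mono2 prod_nonneg finite_PiE) (fastforce simp: rivals_def PiE_iff extensional_def)+
    also have "\<dots> = (\<Prod>p<k. \<Sum>v\<in>?D p. ?w p v)"
      using finite_V by (subst prod_sum_PiE) auto
    also have "\<dots> = (\<Sum>v\<in>V - {y}. ?w 0 v) * (\<Prod>p=1..<k. \<Sum>v\<in>V. ?w p v)"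
      by (simp add: prod_split_0)
    also have "(\<Sum>v\<in>V - {y}. ?w 0 v) \<le> s" using off[of 0] tuple_nth_0[OF a] by simp
    also have "(\<Prod>p=1..<k. \<Sum>v\<in>V. ?w p v) \<le> (\<Prod>p=1..<k. exp s)"
    proof (rule prod_mono)
      fix p assume p: "p \<in> {1..<k}"
      then have "a p \<in> V" using tuple_image_sub[OF a] by auto
      then have "(\<Sum>v\<in>V. ?w p v) = 1 + (\<Sum>v\<in>V - {a p}. ?w p v)"
        using finite_V by (simp add: sum.remove)
      also have "\<dots> \<le> 1 + s" using off by simp
      also have "\<dots> \<le> exp s" by (rule exp_ge_add_one_self)
      finally show "0 \<le> (\<Sum>v\<in>V. ?w p v) \<and> (\<Sum>v\<in>V. ?w p v) \<le> exp s"
        using w by (auto intro: sum_nonneg)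
    qed
    also have "(\<Prod>p=1..<k. exp s) \<le> exp (k * s)"
      using pos by (simp flip: exp_of_nat_mult)
    finally show ?thesis
      using pos w by (simp add: mult_left_mono mult_right_mono sum_nonneg prod_nonneg)
  qed
  note inner = this
  let ?K = "p1 * exp (3 * k * q + 4 * card V * q\<^sup>2)"
  have "(\<Sum>b\<in>rivals. dens (pairs V) (\<lambda>S. dominates V S (a ` {..<k}) \<and>
      dominates V S (b ` {..<k}) \<and> same_pattern k S a b)) \<le> ?K * (s * exp (k * s))"
    if "a \<in> tuples" for a
  proof -
    have "(\<Sum>b\<in>rivals. dens (pairs V) (\<lambda>S. dominates V S (a ` {..<k}) \<and>
        dominates V S (b ` {..<k}) \<and> same_pattern k S a b)) \<le>
      (\<Sum>b\<in>rivals. ?K * (\<Prod>p<k. if b p = a p then 1 else if b p \<in> a ` {..<k} then \<alpha> else \<alpha> * \<sigma>))"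
      using that by (intro sum_mono dens_conflict)
    also have "\<dots> \<le> ?K * (s * exp (k * s))"
      unfolding sum_distrib_left[symmetric] using inner[OF that] p1_pos by (intro mult_left_mono) auto
    finally show ?thesis .
  qed
  then have "(\<Sum>a\<in>tuples. \<Sum>b\<in>rivals. dens (pairs V) (\<lambda>S. dominates V S (a ` {..<k}) \<and>
      dominates V S (b ` {..<k}) \<and> same_pattern k S a b))
    \<le> real (card tuples) * (?K * (s * exp (k * s)))"
    by (rule sum_bounded_above)
  then show ?thesis by (simp add: card_tuples \<mu>_def mult_ac)
qed

text \<open>If there are more than \<open>\<mu> / 2\<close> dominating tuples and fewer than
  \<open>\<mu> / 2\<close> conflicts, some dominating tuple is in no conflict, and it pins
  y.\<close>

lemma dens_not_pinned_le:
  "dens (pairs V) (\<lambda>S. \<not> (\<exists>a. pins V S k a \<and> a 0 = y)) \<le>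
    4 * (exp (4 * k * q + 2 * card V * q\<^sup>2 + k * \<rho> / m) - 1) +
    2 * (exp (3 * k * q + 4 * card V * q\<^sup>2) * (s * exp (k * s)))"
    (is "_ \<le> 4 * (exp ?x - 1) + 2 * ?\<eta>")
proof -
  define X where "X = (\<lambda>S. real (card {a \<in> tuples. dominates V S (a ` {..<k})}))"
  define conf where "conf = (\<lambda>(a, b) S. dominates V S (a ` {..<k}) \<and>
      dominates V S (b ` {..<k}) \<and> same_pattern k S a b)"
  define C where "C = (\<lambda>S. real (card {ab \<in> tuples \<times> rivals. conf ab S}))"
  have fin: "finite (pairs V)" using finite_V by simp
  have "dens (pairs V) (\<lambda>S. X S \<le> \<mu> / 2) \<le> 4 * (exp ?x - 1)"
    unfolding X_def using expected_tuples \<mu>_pos second_moment_tuples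
    by (intro second_moment[OF fin finite_tuples]) simp_all
  moreover have "dens (pairs V) (\<lambda>S. \<mu> / 2 \<le> C S) \<le> 2 * ?\<eta>"
  proof -
    have "avg (pairs V) C = (\<Sum>ab\<in>tuples \<times> rivals. dens (pairs V) (conf ab))"
      unfolding C_def using finite_tuples finite_rivals by (intro avg_card) auto
    also have "\<dots> = (\<Sum>a\<in>tuples. \<Sum>b\<in>rivals. dens (pairs V) (\<lambda>S. dominates V S (a ` {..<k}) \<and>
        dominates V S (b ` {..<k}) \<and> same_pattern k S a b))"
      by (simp add: sum.cartesian_product conf_def case_prod_unfold)
    also have "\<dots> \<le> \<mu> * ?\<eta>" by (rule expected_conflicts)
    finally have "avg (pairs V) C / (\<mu> / 2) \<le> \<mu> * ?\<eta> / (\<mu> / 2)"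
      using \<mu>_pos by (intro divide_right_mono) auto
    moreover have "dens (pairs V) (\<lambda>S. \<mu> / 2 \<le> C S) \<le> avg (pairs V) C / (\<mu> / 2)"
      using \<mu>_pos by (intro dens_markov) (auto simp: C_def)
    ultimately show ?thesis using \<mu>_pos by simp
  qed
  moreover have "dens (pairs V) (\<lambda>S. \<not> (\<exists>a. pins V S k a \<and> a 0 = y)) \<le>
      dens (pairs V) (\<lambda>S. X S \<le> \<mu> / 2 \<or> \<mu> / 2 \<le> C S)"
  proof (rule dens_mono, rule ccontr)
    fix S assume S: "S \<subseteq> pairs V" and none: "\<not> (\<exists>a. pins V S k a \<and> a 0 = y)"
      and "\<not> (X S \<le> \<mu> / 2 \<or> \<mu> / 2 \<le> C S)"
    then have CX: "C S < X S" by simp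
    have "{a \<in> tuples. dominates V S (a ` {..<k})} \<subseteq> fst ` {ab \<in> tuples \<times> rivals. conf ab S}"
    proof
      fix a assume "a \<in> {a \<in> tuples. dominates V S (a ` {..<k})}"
      then have a: "a \<in> tuples" "dominates V S (a ` {..<k})" by auto
      then have "dom_tuple V S k a"
        by (simp add: dom_tuple_def tuple_inj tuple_image_sub)
      then obtain b where b: "dom_tuple V S k b" "same_pattern k S a b" "b 0 \<noteq> y"
        using none tuple_nth_0[OF a(1)] unfolding pins_def by auto
      \<comment> \<open>\<open>rivals\<close> contains extensional functions only, so values beyond
        k are normalised.\<close>
      define b' where "b' = restrict b {..<k}"
      have im: "b' ` {..<k} = b ` {..<k}" by (simp add: b'_def)
      have "b' \<in> rivals"
        using b k unfolding rivals_def dom_tuple_def b'_def by (auto simp: inj_on_def)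
      moreover have "conf (a, b') S"
        using a(2) b(1,2) im by (simp add: conf_def dom_tuple_def same_pattern_def b'_def)
      ultimately show "a \<in> fst ` {ab \<in> tuples \<times> rivals. conf ab S}"
        using a(1) by (intro image_eqI[of _ _ "(a, b')"]) auto
    qed
    then have "card {a \<in> tuples. dominates V S (a ` {..<k})} \<le> card {ab \<in> tuples \<times> rivals. conf ab S}"
      using finite_tuples finite_rivals by (intro surj_card_le) auto
    then show False using CX by (simp add: X_def C_def)
  qed
  ultimately show ?thesis
    using dens_disj_le[of "pairs V" "\<lambda>S. X S \<le> \<mu> / 2" "\<lambda>S. \<mu> / 2 \<le> C S"] by linarith
qed

end

section \<open>The random graph\<close>

lemma dens_not_separates_le:
  assumes V: "finite V" and Y: "Y \<subseteq> V"
  shows "dens (pairs V) (\<lambda>S. \<not> separates V S Y) \<le> (card V)\<^sup>2 / 2 ^ card Y"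
proof -
  define I where "I = {(x, x') \<in> (V - Y) \<times> (V - Y). x \<noteq> x'}"
  have I: "finite I" "card I \<le> (card V)\<^sup>2"
  proof -
    have sub: "I \<subseteq> V \<times> V" by (auto simp: I_def)
    then show "finite I" using V finite_subset by blast
    show "card I \<le> (card V)\<^sup>2"
      using card_mono[OF _ sub] V by (simp add: card_cartesian_product power2_eq_square)
  qed
  have "dens (pairs V) (\<lambda>S. \<not> separates V S Y) \<le>
      dens (pairs V) (\<lambda>S. \<exists>xx\<in>I. \<forall>y\<in>Y. {fst xx, y} \<in> S \<longleftrightarrow> {snd xx, y} \<in> S)"
    by (rule dens_mono) (auto simp: separates_def I_def)
  also have "\<dots> \<le> (\<Sum>xx\<in>I. dens (pairs V) (\<lambda>S. \<forall>y\<in>Y. {fst xx, y} \<in> S \<longleftrightarrow> {snd xx, y} \<in> S))"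
    using I(1) by (rule dens_Bex_le)
  also have "\<dots> \<le> real (card I) * (1 / 2 ^ card Y)"
  proof (rule sum_bounded_above)
    fix xx assume "xx \<in> I"
    then obtain x x' where xx: "xx = (x, x')" "x \<in> V - Y" "x' \<in> V - Y" "x \<noteq> x'" by (auto simp: I_def)
    show "dens (pairs V) (\<lambda>S. \<forall>y\<in>Y. {fst xx, y} \<in> S \<longleftrightarrow> {snd xx, y} \<in> S) \<le> 1 / 2 ^ card Y"
      unfolding xx fst_conv snd_conv
      using V Y xx(2-4) by (intro dens_match_le) (auto simp: inj_on_def doubleton_eq_iff)
  qed
  also have "\<dots> \<le> (card V)\<^sup>2 / 2 ^ card Y"
  proof -
    have "real (card I) \<le> real ((card V)\<^sup>2)" using I(2) by (rule of_nat_mono)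
    then show ?thesis by (simp add: field_simps)
  qed
  finally show ?thesis .
qed

section \<open>The random graph as a uniformly random edge set\<close>

lemma labelled_graphs_eq: "labelled_graphs n = graph_of {1..n} ` Pow (pairs {1..n})"
proof
  show "graph_of {1..n} ` Pow (pairs {1..n}) \<subseteq> labelled_graphs n"
    by (auto simp: labelled_graphs_def pair_graph_graph_of)
  show "labelled_graphs n \<subseteq> graph_of {1..n} ` Pow (pairs {1..n})"
  proof
    fix G assume "G \<in> labelled_graphs n"
    then have G: "pair_graph G" and V: "pverts G = {1..n}" by (auto simp: labelled_graphs_def)
    interpret pair_graph G by fact
    define S where "S = (\<lambda>(u, v). {u, v}) ` parcs G"
    have "S \<subseteq> pairs {1..n}"
      unfolding S_def using V[symmetric] no_loops' in_arcsD1 in_arcsD2 by auto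
    moreover have "(v, u) \<in> parcs G" if "(u, v) \<in> parcs G" for u v
      using that arcs_symmetric by simp
    then have "(u, v) \<in> parcs G \<longleftrightarrow> {u, v} \<in> S" for u v
      unfolding S_def by (auto simp: doubleton_eq_iff)
    then have "G = graph_of {1..n} S"
      using V unfolding graph_of_def by (intro pair_pre_digraph.equality) auto
    ultimately show "G \<in> graph_of {1..n} ` Pow (pairs {1..n})" by blast
  qed
qed

lemma inj_on_graph_of: "inj_on (graph_of V) (Pow (pairs V))"
proof (rule inj_onI)
  fix S T assume S: "S \<in> Pow (pairs V)" and T: "T \<in> Pow (pairs V)" and eq: "graph_of V S = graph_of V T"
  have "{u, v} \<in> S \<longleftrightarrow> {u, v} \<in> T" for u v
    using eq parcs_graph_of by metis
  moreover have "\<exists>u v. e = {u, v}" if "e \<in> S \<union> T" for e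
    using that S T by (auto simp: pairs_def card_2_iff) blast+
  ultimately show "S = T" by blast
qed

lemma prob_random_graph:
  "measure_pmf.prob (random_graph n) {G. P G} = dens (pairs {1..n}) (\<lambda>S. P (graph_of {1..n} S))"
proof -
  let ?E = "pairs {1..n}"
  have "labelled_graphs n \<inter> {G. P G} = graph_of {1..n} ` {S \<in> Pow ?E. P (graph_of {1..n} S)}"
    by (auto simp: labelled_graphs_eq)
  also have "card \<dots> = card {S \<in> Pow ?E. P (graph_of {1..n} S)}"
    by (intro card_image inj_on_subset[OF inj_on_graph_of]) auto
  finally show ?thesis
    using finite_labelled_graphs labelled_graphs_nonempty
    by (simp add: random_graph_def measure_pmf_of_set dens_eq_card labelled_graphs_eq
        card_image[OF inj_on_graph_of] card_Pow)
qed

text \<open>Vertices 1..r are reserved for Y, so that the same blocks serve every y.\<close>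

definition block :: "nat \<Rightarrow> nat \<Rightarrow> nat \<Rightarrow> nat \<Rightarrow> nat set" where
  "block r m y p = (if p = 0 then {y} else {r + (p - 1) * m <.. r + p * m})"

lemma tuple_blocks_block:
  assumes "k \<ge> 2" "n \<ge> 4 * k" "m \<ge> 1" "r + (k - 1) * m \<le> n" "y \<in> {1..r}"
  shows "tuple_blocks {1..n} k m y (block r m y)"
proof
  have le: "r + p * m \<le> n" if "p < k" for p
  proof -
    have "p * m \<le> (k - 1) * m" using that by (intro mult_right_mono) auto
    then show ?thesis using assms(4) by linarith
  qed
  show "block r m y p \<subseteq> {1..n}" if "p < k" for p
    using le[OF that] le[of 0] assms(1,5) by (auto simp: block_def)
  show "card (block r m y p) = m" if "0 < p" for p
    using that by (cases p) (auto simp: block_def)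
  have less: "block r m y p \<inter> block r m y p' = {}" if "p < p'" for p p'
  proof (cases "p = 0")
    case True
    then show ?thesis using that assms(5) by (auto simp: block_def)
  next
    case False
    have "p * m \<le> (p' - 1) * m" using that by (intro mult_right_mono) auto
    then show ?thesis using False that by (auto simp: block_def)
  qed
  show "disjoint_family_on (block r m y) {..<k}"
    unfolding disjoint_family_on_def using less by (metis Int_commute nat_neq_iff)
qed (use assms in \<open>auto simp: block_def\<close>)

text \<open>With k = j + 3 this is 5/8 k^2 2^k; the shift by 3 clears the denominator 8. It is also
  5 k m for blocks of size m = k 2^j, which leaves ample room for k - 1 of them.\<close>

definition critical_order :: "nat \<Rightarrow> nat" where
  "critical_order j = 5 * (j + 3)\<^sup>2 * 2 ^ j"

text \<open>
  Dominates the sum of all failure probabilities, with \<open>x = k\<close>; the rational exponents come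
  from 2/3 \<le> ln 2 \<le> 25/36.
\<close>
definition failure_bound :: "real \<Rightarrow> real" where
  "failure_bound x =
    (let e = exp (- 2 / 3 * x);
      t = 4 * x * e + 5 / 4 * x\<^sup>2 * e + 8 * exp (5 / 8 * x\<^sup>2 * (1 + 4 * e) / (x - 1) - 2 / 3 * x);
      s = 2 * x * exp (- x / 9) + 5 / 4 * x\<^sup>2 * exp (- 5 / 108 * x)
     in 3 * x * (4 * (exp t - 1) + 2 * (exp (3 * x * e + 5 / 2 * x\<^sup>2 * e) * (s * exp (x * s)))) + x ^ 4 * e)"

text \<open>In t the decisive rate is 5/8 - 2/3 < 0, and both terms of s decay exponentially as
  well. This beats the polynomial factors, including the 3 x from the union bound over Y.\<close>

lemma failure_bound_tendsto_0: "(failure_bound \<longlongrightarrow> 0) at_top"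
  unfolding failure_bound_def Let_def by real_asymp

lemma dens_not_definable_le:
  fixes j :: nat
  defines "k \<equiv> j + 3" and "n \<equiv> critical_order j"
  shows "dens (pairs {1..n}) (\<lambda>S. \<not> def_depth 2 (graph_of {1..n} S) \<le> enat (k + 3)) \<le> failure_bound (real k)"
proof -
  \<comment> \<open>Two vertices agree on Y with probability 2^(- r), and there are about n^2 pairs.
    As n is 2^k up to a polynomial factor, 2 k elements would not be enough, while 3 k leave (n q)^2
    q.\<close>
  define r where "r = 3 * k"
  define m where "m = k * 2 ^ j"
  define Y where "Y = {1..r}"
  define x where "x = real k"
  define e where "e = exp (- 2 / 3 * x)"
  have x3: "x \<ge> 3" by (simp add: x_def k_def)
  have k3: "k \<ge> 3" by (simp add: k_def)
  have k2j: "k \<le> m" by (simp add: m_def)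
  have n_eq: "n = 5 * k * m" by (simp add: n_def critical_order_def m_def k_def power2_eq_square)
  have km: "3 * k \<le> k * m" "k \<le> k * m"
    using k2j k3 mult_le_mono[of 3 m k k] mult_le_mono[of 1 m k k] by (simp_all add: mult.commute)
  have n4: "4 * k \<le> n" using km unfolding n_eq by linarith
  have blocks: "r + (k - 1) * m \<le> n"
  proof -
    have "(k - 1) * m \<le> k * m" by (intro mult_right_mono) auto
    then show ?thesis using km unfolding n_eq r_def by linarith
  qed
  have rn: "r \<le> n" using blocks by simp
  have pw: "(2::real) ^ k = 8 * 2 ^ j" by (simp add: k_def power_add)
  have pw_exp: "(2::real) ^ k = exp (ln 2 * x)"
    by (simp add: x_def mult.commute exp_of_nat_mult)
  define q where q_eq: "q = 1 / (2::real) ^ k"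
  have nq: "real n * q = 5 / 8 * x\<^sup>2"
    using pw by (simp add: n_eq m_def q_eq x_def power2_eq_square field_simps)
  have q_le: "q \<le> e" "0 < q"
  proof -
    have "q = exp (- (ln 2 * x))"
      unfolding q_eq pw_exp by (simp add: exp_minus field_simps)
    also have "\<dots> \<le> e"
      unfolding e_def using ln2_ge_two_thirds x3 by (simp add: mult_right_mono)
    finally show "q \<le> e" .
  qed (simp add: q_eq)
  have m_eq: "real k / real m = 8 * q"
    using pw k3 by (simp add: m_def q_eq field_simps)
  have nq2: "real n * q\<^sup>2 \<le> 5 / 8 * x\<^sup>2 * e"
  proof -
    have "real n * q\<^sup>2 = 5 / 8 * x\<^sup>2 * q"
      unfolding power2_eq_square[of q] mult.assoc[symmetric] nq by simp
    also have "\<dots> \<le> 5 / 8 * x\<^sup>2 * e" using q_le by (intro mult_left_mono) auto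
    finally show ?thesis .
  qed
  define \<rho> where \<rho>_eq: "\<rho> = exp (real n * q * (1 + 4 * q) / (k - 1))"
  define \<alpha> where \<alpha>_eq: "\<alpha> = 2 powr (- (real k - 2) / 6)"
  define \<sigma> where \<sigma>_eq: "\<sigma> = exp (- (real n * q / k))"
  define s where s_eq: "s = \<alpha> * (k + real n * \<sigma>)"
  have \<rho>: "k * \<rho> / m \<le> 8 * exp (5 / 8 * x\<^sup>2 * (1 + 4 * e) / (x - 1) - 2 / 3 * x)"
  proof -
    have "\<rho> \<le> exp (5 / 8 * x\<^sup>2 * (1 + 4 * e) / (x - 1))"
      unfolding \<rho>_eq nq using q_le x3 k3
      by (simp add: x_def of_nat_diff divide_right_mono mult_left_mono)
    then have "8 * q * \<rho> \<le> 8 * e * exp (5 / 8 * x\<^sup>2 * (1 + 4 * e) / (x - 1))"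
      using q_le by (intro mult_mono) (auto simp: \<rho>_eq)
    also have "\<dots> = 8 * (exp (5 / 8 * x\<^sup>2 * (1 + 4 * e) / (x - 1)) * exp (- (2 / 3 * x)))"
      unfolding e_def by simp
    also have "\<dots> = 8 * exp (5 / 8 * x\<^sup>2 * (1 + 4 * e) / (x - 1) - 2 / 3 * x)"
      unfolding exp_add[symmetric] by simp
    also have "8 * q * \<rho> = k * \<rho> / m" using m_eq by (metis times_divide_eq_left)
    finally show ?thesis .
  qed
  have s: "s \<le> 2 * x * exp (- x / 9) + 5 / 4 * x\<^sup>2 * exp (- 5 / 108 * x)"
  proof -
    have \<alpha>: "\<alpha> = 2 powr (1 / 3) * exp (- (ln 2 * x / 6))"
      unfolding \<alpha>_eq powr_def x_def[symmetric]
      by (simp add: algebra_simps diff_divide_distrib flip: exp_add)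
    have c: "2 powr (1 / 3) \<le> (2::real)"
      using powr_mono[of "1 / 3" 1 "2::real"] by simp
    \<comment> \<open>1/9 is a sixth of the lower bound 2/3 for ln 2; the constant 2^(1/3) is
      rounded up to 2.\<close>
    have "\<alpha> \<le> 2 * exp (- x / 9)"
      unfolding \<alpha> using c ln2_ge_two_thirds x3 by (intro mult_mono) auto
    moreover have "\<alpha> * (real n * \<sigma>) \<le> 5 / 4 * x\<^sup>2 * exp (- 5 / 108 * x)"
    proof -
      have "real n = 5 / 8 * x\<^sup>2 * exp (ln 2 * x)"
        using nq by (simp add: q_eq pw_exp field_simps)
      moreover have "\<sigma> = exp (- (5 / 8 * x))"
        unfolding \<sigma>_eq nq x_def[symmetric] using x3 by (simp add: power2_eq_square)
      ultimately have "\<alpha> * (real n * \<sigma>) =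
          2 powr (1 / 3) * (5 / 8 * x\<^sup>2) * exp (ln 2 * x + - (ln 2 * x / 6) + - (5 / 8 * x))"
        unfolding \<alpha> exp_add by simp
      also have "\<dots> \<le> 2 powr (1 / 3) * (5 / 8 * x\<^sup>2) * exp (- 5 / 108 * x)"
      proof -
        have "ln 2 * x \<le> 25 / 36 * x" using ln2_le_25_over_36 x3 by (intro mult_right_mono) auto
        \<comment> \<open>5/108 = 5/8 - 5/6 * 25/36: the margin in 5/8 > 5/6 ln 2 after bounding ln
          2 by 25/36.\<close>
        then have "ln 2 * x + - (ln 2 * x / 6) + - (5 / 8 * x) \<le> - 5 / 108 * x" by linarith
        then show ?thesis by (intro mult_left_mono iffD2[OF exp_le_cancel_iff]) auto
      qed
      also have "2 powr (1 / 3) * (5 / 8 * x\<^sup>2) * exp (- 5 / 108 * x) \<le>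
          2 * (5 / 8 * x\<^sup>2) * exp (- 5 / 108 * x)"
        using c by (intro mult_right_mono) auto
      finally show ?thesis by simp
    qed
    ultimately have "\<alpha> * x + \<alpha> * (real n * \<sigma>) \<le>
        2 * exp (- x / 9) * x + 5 / 4 * x\<^sup>2 * exp (- 5 / 108 * x)"
      using x3 by (intro add_mono mult_right_mono) auto
    then show ?thesis
      by (simp add: s_eq distrib_left x_def mult_ac)
  qed
  have s0: "0 \<le> s" by (simp add: s_eq \<alpha>_eq \<sigma>_eq)
  define tt where "tt = 4 * x * e + 5 / 4 * x\<^sup>2 * e + 8 * exp (5 / 8 * x\<^sup>2 * (1 + 4 * e) / (x - 1) - 2 / 3 * x)"
  define ss where "ss = 2 * x * exp (- x / 9) + 5 / 4 * x\<^sup>2 * exp (- 5 / 108 * x)"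
  define \<delta> where "\<delta> = 4 * (exp tt - 1) + 2 * (exp (3 * x * e + 5 / 2 * x\<^sup>2 * e) * (ss * exp (x * ss)))"
  have combine: "d \<le> 4 * (a' - 1) + 2 * b'"
    if "b \<le> b'" "a \<le> a'" "d \<le> 4 * (a - 1) + 2 * b" for a b a' b' d :: real
    using that(3) by (rule order.trans) (intro add_mono mult_left_mono diff_right_mono that; simp)
  have pinned: "dens (pairs {1..n}) (\<lambda>S. \<not> (\<exists>a. pins {1..n} S k a \<and> a 0 = y)) \<le> \<delta>" if "y \<in> Y" for y
  proof -
    interpret tuple_blocks "{1..n}" k m y "block r m y"
      using k3 n4 k2j blocks that by (intro tuple_blocks_block) (auto simp: Y_def)
    have eqs: "tuple_blocks.q k = q" "tuple_blocks.\<rho> {1..n} k = \<rho>"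
        "tuple_blocks.s {1..n} k = s"
      unfolding q_eq local.q_def local.\<rho>_def local.s_def local.\<alpha>_def local.\<sigma>_def
        \<rho>_eq s_eq \<alpha>_eq \<sigma>_eq by simp_all
    have kx: "real k = x" by (simp add: x_def)
    have xq: "x * q \<le> x * e" using q_le x3 by (intro mult_left_mono) auto
    have t1: "4 * x * q + 2 * n * q\<^sup>2 + k * \<rho> / m \<le> tt"
      unfolding tt_def using xq nq2 \<rho> by simp
    have t2: "3 * x * q + 4 * n * q\<^sup>2 \<le> 3 * x * e + 5 / 2 * x\<^sup>2 * e"
      using xq nq2 by simp
    have "s \<le> ss" using s by (simp add: ss_def)
    then have t3: "s * exp (x * s) \<le> ss * exp (x * ss)"
      using s0 x3 by (intro mult_mono) (auto simp: mult_left_mono)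
    have "exp (3 * x * q + 4 * n * q\<^sup>2) * (s * exp (x * s)) \<le>
        exp (3 * x * e + 5 / 2 * x\<^sup>2 * e) * (ss * exp (x * ss))"
      using t2 s0 by (intro mult_mono[OF _ t3]) auto
    moreover have "exp (4 * x * q + 2 * n * q\<^sup>2 + k * \<rho> / m) \<le> exp tt" using t1 by simp
    moreover have "dens (pairs {1..n}) (\<lambda>S. \<not> (\<exists>a. pins {1..n} S k a \<and> a 0 = y)) \<le>
        4 * (exp (4 * x * q + 2 * n * q\<^sup>2 + k * \<rho> / m) - 1) +
        2 * (exp (3 * x * q + 4 * n * q\<^sup>2) * (s * exp (x * s)))"
      using dens_not_pinned_le unfolding eqs by (simp add: x_def)
    ultimately show ?thesis unfolding \<delta>_def by (rule combine)
  qed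
  have "dens (pairs {1..n}) (\<lambda>S. \<not> def_depth 2 (graph_of {1..n} S) \<le> enat (k + 3)) \<le>
      dens (pairs {1..n}) (\<lambda>S. (\<exists>y\<in>Y. \<not> (\<exists>a. pins {1..n} S k a \<and> a 0 = y)) \<or> \<not> separates {1..n} S Y)"
  proof (rule dens_mono, rule ccontr)
    fix S assume S: "S \<subseteq> pairs {1..n}" and not: "\<not> def_depth 2 (graph_of {1..n} S) \<le> enat (k + 3)"
      and good: "\<not> ((\<exists>y\<in>Y. \<not> (\<exists>a. pins {1..n} S k a \<and> a 0 = y)) \<or> \<not> separates {1..n} S Y)"
    have "def_depth 2 (graph_of {1..n} S) \<le> enat (k + 3)"
      by (rule def_depth_graph_of_le[of _ _ Y]) (use S good k3 rn in \<open>auto simp: Y_def\<close>)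
    then show False using not by simp
  qed
  also have "\<dots> \<le> (\<Sum>y\<in>Y. dens (pairs {1..n}) (\<lambda>S. \<not> (\<exists>a. pins {1..n} S k a \<and> a 0 = y))) +
      (card {1..n})\<^sup>2 / 2 ^ card Y"
    by (rule order.trans[OF dens_disj_le add_mono[OF dens_Bex_le dens_not_separates_le]])
      (use rn in \<open>auto simp: Y_def\<close>)
  also have "(\<Sum>y\<in>Y. dens (pairs {1..n}) (\<lambda>S. \<not> (\<exists>a. pins {1..n} S k a \<and> a 0 = y))) \<le> real (card Y) * \<delta>"
    by (rule sum_bounded_above) (rule pinned)
  also have "real (card Y) = 3 * x" by (simp add: Y_def r_def x_def)
  also have "(card {1..n})\<^sup>2 / 2 ^ card Y \<le> x ^ 4 * e"
  proof -
    have "(card {1..n})\<^sup>2 / 2 ^ card Y = (real n * q)\<^sup>2 * q"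
      by (simp add: Y_def r_def q_eq power2_eq_square power_mult power3_eq_cube mult.commute[of 3])
    also have "\<dots> = 25 / 64 * x ^ 4 * q" unfolding nq by (simp add: power2_eq_square power4_eq_xxxx)
    also have "\<dots> \<le> 1 * x ^ 4 * e" using q_le x3 by (intro mult_mono) auto
    finally show ?thesis by simp
  qed
  finally show ?thesis
    unfolding failure_bound_def Let_def x_def[symmetric] e_def[symmetric] ss_def[symmetric] tt_def[symmetric]
      \<delta>_def[symmetric] by simp
qed

text \<open>The true size of ln n is about x ln 2, but ln n \<le> x is enough. The constants left
  over, log 2 (5/8) + log 2 (ln 2), are about - 1.2, and only - 3 has to be reached, the gap between
  depth k + 3 and the constant 6.\<close>

lemma depth_bound_eventually:
  "eventually (\<lambda>j. real (j + 6) \<le> log 2 (critical_order j) - 2 * log 2 (ln (critical_order j)) + log 2 (ln 2) + 6) sequentially"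
proof -
  have "eventually (\<lambda>j::nat. 25 / 36 * (real j + 3) + 2 * ln (real j + 3) \<le> real j + 3) sequentially"
    by real_asymp
  then show ?thesis
  proof eventually_elim
    case (elim j)
    define x where "x = real j + 3"
    have x: "x \<ge> 3" by (simp add: x_def)
    have n: "real (critical_order j) = 5 / 8 * x\<^sup>2 * 2 powr x"
      by (simp add: critical_order_def x_def powr_add powr_realpow)
    have lnn: "ln (real (critical_order j)) = ln (5 / 8) + 2 * ln x + x * ln 2"
    proof -
      have "ln (5 / 8 * x\<^sup>2 * 2 powr x) = ln (5 / 8 * x\<^sup>2) + ln (2 powr x)"
        using x by (intro ln_mult_pos) auto
      also have "ln (5 / 8 * x\<^sup>2) = ln (5 / 8) + ln (x\<^sup>2)"
        using x by (intro ln_mult_pos) auto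
      finally show ?thesis unfolding n using x by (simp add: ln_realpow)
    qed
    have "x * ln 2 \<le> x * (25 / 36)" using ln2_le_25_over_36 x by (intro mult_left_mono) auto
    moreover have "ln (5 / 8 :: real) \<le> 0" by simp
    ultimately have le: "ln (real (critical_order j)) \<le> x"
      using elim unfolding lnn x_def[symmetric] by linarith
    have "x * (2 / 3) \<le> x * ln 2" using ln2_ge_two_thirds x by (intro mult_left_mono) auto
    moreover have "1 \<le> ln x" using x exp_le by (simp add: ln_ge_iff)
    moreover have "ln (5 / 8 :: real) \<ge> - 1"
      using ln_add_one_self_le_self2[of "3 / 5"] ln_inverse[of "8 / 5"] by simp
    ultimately have pos: "ln (real (critical_order j)) > 0" unfolding lnn using x by linarith
    have "log 2 (ln (real (critical_order j))) \<le> log 2 x" using le pos by simp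
    moreover have "log 2 (real (critical_order j)) = log 2 (5 / 8) + 2 * log 2 x + x"
    proof -
      have "log 2 (5 / 8 * x\<^sup>2 * 2 powr x) = log 2 (5 / 8 * x\<^sup>2) + log 2 (2 powr x)"
        using x by (intro log_mult_pos) auto
      also have "log 2 (5 / 8 * x\<^sup>2) = log 2 (5 / 8) + log 2 (x\<^sup>2)"
        using x by (intro log_mult_pos) auto
      finally show ?thesis unfolding n using x by (simp add: log_nat_power)
    qed
    moreover have "- 3 \<le> log 2 (5 / 8) + log 2 (ln 2)"
    proof -
      have "log 2 (1 / 8 :: real) \<le> log 2 (5 / 8 * ln 2)"
        using ln2_ge_two_thirds by simp
      moreover have "log 2 (1 / 8 :: real) = - 3"
        using log_pow_cancel[of "2 :: real" 3] by (simp add: log_divide)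
      moreover have "log 2 (5 / 8 * ln 2) = log 2 (5 / 8) + log 2 (ln 2 :: real)"
        by (intro log_mult_pos) auto
      ultimately show ?thesis by simp
    qed
    ultimately show ?case by (simp add: x_def)
  qed
qed

section \<open>Passing to the sequence of critical orders\<close>

lemma strict_mono_critical_order: "strict_mono critical_order"
proof (rule strict_monoI)
  fix i j :: nat assume "i < j"
  then have "(i + 3)\<^sup>2 < (j + 3)\<^sup>2" "(2::nat) ^ i \<le> 2 ^ j"
    by (intro power_strict_mono power_increasing; simp)+
  then show "critical_order i < critical_order j"
    unfolding critical_order_def by (intro mult_less_le_imp_less[of "5 * (i + 3)\<^sup>2"]) simp_all
qed

lemma eventually_along_range:
  assumes "strict_mono (f :: nat \<Rightarrow> nat)" "eventually (\<lambda>j. P (f j)) sequentially"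
  shows "eventually P (inf at_top (principal (range f)))"
proof -
  obtain J where J: "\<And>j. j \<ge> J \<Longrightarrow> P (f j)"
    using assms(2) by (auto simp: eventually_sequentially)
  have "eventually (\<lambda>n. n \<in> range f \<longrightarrow> P n) at_top"
    using J assms(1) by (intro eventually_at_top_linorderI[of "f J"]) (auto simp: strict_mono_less_eq)
  then show ?thesis by (simp add: eventually_inf_principal)
qed

theorem theorem4p1:
  shows "\<exists>N :: nat set. infinite N \<and> (\<forall>n\<in>N. n > 0) \<and>
    (\<exists>\<epsilon> :: nat \<Rightarrow> real.
      (\<epsilon> \<longlongrightarrow> 0) (inf at_top (principal N)) \<and>
      ((\<lambda>n. measure_pmf.prob (random_graph n)
          {G. ereal_of_enat (def_depth 2 G) \<le>
              ereal (log 2 (real n) - 2 * log 2 (ln (real n)) + log 2 (ln 2) + 6 + \<epsilon> n)})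
        \<longlongrightarrow> 1) (inf at_top (principal N)))"
proof (intro exI[of _ "range critical_order"] conjI exI[of _ "\<lambda>_. 0"])
  \<comment> \<open>The error term is chosen to be 0: the slack in the constant already absorbs all
    lower-order terms for large n.\<close>
  let ?b = "\<lambda>n. log 2 (real n) - 2 * log 2 (ln (real n)) + log 2 (ln 2) + 6"
  let ?P = "\<lambda>n. measure_pmf.prob (random_graph n)
    {G. ereal_of_enat (def_depth 2 G) \<le> ereal (?b n + 0)}"
  have lim: "filterlim (\<lambda>j::nat. real (j + 3)) at_top sequentially" by real_asymp
  have lower: "eventually (\<lambda>j. 1 - failure_bound (real (j + 3)) \<le> ?P (critical_order j)) sequentially"
    using depth_bound_eventually
  proof eventually_elim
    case (elim j)
    let ?n = "critical_order j"
    have "1 - failure_bound (real (j + 3)) \<le>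
        1 - dens (pairs {1..?n}) (\<lambda>S. \<not> def_depth 2 (graph_of {1..?n} S) \<le> enat (j + 3 + 3))"
      using dens_not_definable_le[of j] by simp
    also have "\<dots> = measure_pmf.prob (random_graph ?n) {G. def_depth 2 G \<le> enat (j + 3 + 3)}"
      unfolding prob_random_graph by (simp add: dens_not)
    also have "\<dots> \<le> ?P ?n"
    proof (rule measure_pmf.finite_measure_mono)
      have "ereal_of_enat (def_depth 2 G) \<le> ereal (?b ?n + 0)" if "def_depth 2 G \<le> enat (j + 3 + 3)" for G
      proof -
        have "ereal_of_enat (def_depth 2 G) \<le> ereal_of_enat (enat (j + 3 + 3))"
          using that by (simp only: ereal_of_enat_le_iff)
        also have "\<dots> \<le> ereal (?b ?n + 0)" using elim by (simp add: algebra_simps)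
        finally show ?thesis .
      qed
      then show "{G. def_depth 2 G \<le> enat (j + 3 + 3)} \<subseteq>
          {G. ereal_of_enat (def_depth 2 G) \<le> ereal (?b ?n + 0)}" by blast
    qed simp
    finally show ?case .
  qed
  have fail: "((\<lambda>j. 1 - failure_bound (real (j + 3))) \<longlongrightarrow> 1) sequentially"
    using tendsto_diff[OF tendsto_const filterlim_compose[OF failure_bound_tendsto_0 lim], of 1] by simp
  show "(?P \<longlongrightarrow> 1) (inf at_top (principal (range critical_order)))"
  proof (rule order_tendstoI)
    fix c :: real assume "c < 1"
    then have "eventually (\<lambda>j. c < 1 - failure_bound (real (j + 3))) sequentially"
      using fail by (simp add: order_tendsto_iff)
    with lower have "eventually (\<lambda>j. c < ?P (critical_order j)) sequentially"
      by eventually_elim simp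
    then show "eventually (\<lambda>n. c < ?P n) (inf at_top (principal (range critical_order)))"
      by (rule eventually_along_range[OF strict_mono_critical_order])
  next
    fix c :: real assume "1 < c"
    then have "?P n < c" for n
      using measure_pmf.prob_le_1[of "random_graph n"] by (rule order.strict_trans1[rotated])
    then show "eventually (\<lambda>n. ?P n < c) (inf at_top (principal (range critical_order)))"
      by simp
  qed
  show "infinite (range critical_order)"
    using strict_mono_critical_order by (intro range_inj_infinite strict_mono_imp_inj_on)
  show "\<forall>n\<in>range critical_order. n > 0" by (auto simp: critical_order_def)
qed simp

end
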